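(* Let $n\ge1$, identify $\mathbb{R}^{n\times n}$ with $\mathbb{R}^{n^2}$ via the matrix entries, let $Q=[0,1]^{n^2}\subset\mathbb{R}^{n\times n}$, and let $A_1,\dots,A_{2^{n^2}}$ be the vertices of the cube $Q$. Let $\nu$ be a Radon probability measure on $\mathbb{R}^{n\times n}$ whose support is contained in the interior of $Q$. Then $\nu$ is a laminate if and only if $$g(\overline\nu)\le\langle\nu,g\rangle$$ for all $g$ which are extreme points of the convex set $$\Big\{f\colon Q\to[0,\infty)\ :\ \sum_{i=1}^{2^{n^2}}f(A_i)=1,\ f\text{ is rank-one convex}\Big\}.$$
   Context: For a compactly supported Radon probability measure $\nu$ on $\mathbb{R}^{n\times n}$, $\overline\nu=\int_{\mathbb{R}^{n\times n}}A\,d\nu(A)$ denotes its barycentre, and $\langle\nu,g\rangle=\int g\,d\nu$. A function $f\colon Q\to[0,\infty)$ is rank-one convex if $f(\lambda A+(1-\lambda)B)\le\lambda f(A)+(1-\lambda)f(B)$ for all $\lambda\in[0,1]$ and all $A,B\in Q$ with $\operatorname{rank}(A-B)\le1$. An extreme point of a convex set $K$ in a real vector space (here the space of all real-valued functions on $Q$) is a point of $K$ which is not contained in any open line segment contained in $K$. Laminates are understood in the standard sense. The laminates of finite order form the smallest class of finitely supported probability measures on $\mathbb{R}^{n\times n}$ which contains all Dirac masses $\delta_A$ and is closed under splitting: if $\sum_{i=1}^N\lambda_i\delta_{A_i}$ is in the class and $A_N=sB+(1-s)C$ with $s\in[0,1]$ and $\operatorname{rank}(B-C)\le1$, then $\sum_{i=1}^{N-1}\lambda_i\delta_{A_i}+\lambda_N(s\delta_B+(1-s)\delta_C)$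 is in the class (here the $A_i$ may be listed in any order and need not be distinct). A laminate is a compactly supported probability measure that is the weak-$*$ limit of a sequence of laminates of finite order whose supports lie in a common compact set. *)

theory Defs
  imports "HOL-Analysis.Analysis" "HOL-Probability.Giry_Monad" "HOL-Library.Function_Algebras"
begin

text \<open>Pointwise scalar multiplication makes real-valued functions a real vector space (the
  additive structure is the one of \<^theory>\<open>HOL-Library.Function_Algebras\<close>), so that
  \<^const>\<open>extreme_point_of\<close> applies to sets of functions.\<close>

instantiation "fun" :: (type, real_vector) real_vector
begin

definition scaleR_fun_def: "r *\<^sub>R f = (\<lambda>x. r *\<^sub>R f x)"

instance
  by standard (simp_all add: scaleR_fun_def plus_fun_def fun_eq_iff scaleR_add_right scaleR_add_left)

end

definition cubeQ :: "(real^'n^'n) set" where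
  "cubeQ = {A. \<forall>i j. 0 \<le> A $ i $ j \<and> A $ i $ j \<le> 1}"

definition cube_vertices :: "(real^'n^'n) set" where
  "cube_vertices = {A. \<forall>i j. A $ i $ j \<in> {0, 1}}"

lemma bij_betw_cube_vertices:
  "bij_betw (\<lambda>S. \<chi> i j. if (i, j) \<in> S then 1 else 0) (UNIV :: ('n \<times> 'n) set set)
     (cube_vertices :: (real^'n^'n) set)"
  unfolding bij_betw_def
proof
  show "inj (\<lambda>S. (\<chi> i j. if (i, j) \<in> S then 1 else 0) :: real^'n^'n)"
    by (auto simp: inj_on_def vec_eq_iff split: if_splits)
  show "range (\<lambda>S. (\<chi> i j. if (i, j) \<in> S then 1 else 0) :: real^'n^'n) = cube_vertices"
  proof (intro equalityI subsetI)
    fix A :: "real^'n^'n" assume A: "A \<in> cube_vertices"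
    then have "A = (\<chi> i j. if (i, j) \<in> {(i, j). A $ i $ j = 1} then 1 else 0)"
      by (fastforce simp: cube_vertices_def vec_eq_iff)
    then show "A \<in> range (\<lambda>S. (\<chi> i j. if (i, j) \<in> S then 1 else 0))"
      by blast
  qed (auto simp: cube_vertices_def)
qed

lemma finite_cube_vertices: "finite (cube_vertices :: (real^'n^'n) set)"
  using bij_betw_cube_vertices bij_betw_finite finite by blast

lemma card_cube_vertices: "card (cube_vertices :: (real^'n^'n) set) = 2 ^ (CARD('n)\<^sup>2)"
  using bij_betw_same_card[OF bij_betw_cube_vertices]
  by (metis Pow_UNIV card_Pow card_cartesian_product finite power2_eq_square UNIV_Times_UNIV)

definition rank_one_convex_on :: "(real^'n^'n) set \<Rightarrow> (real^'n^'n \<Rightarrow> real) \<Rightarrow> bool" where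
  "rank_one_convex_on S f \<longleftrightarrow>
     (\<forall>A\<in>S. \<forall>B\<in>S. \<forall>t\<in>{0..1}. rank (A - B) \<le> 1 \<longrightarrow>
        f (t *\<^sub>R A + (1 - t) *\<^sub>R B) \<le> t * f A + (1 - t) * f B)"

text \<open>The functions on the cube \<open>Q\<close> are represented by their extensions by zero to all of matrix
  space; this is a linear isomorphism onto the subspace of functions vanishing off \<open>Q\<close>, hence it
  respects extreme points.  No measurability is required.\<close>

definition normalized_rank_one_convex :: "(real^'n^'n \<Rightarrow> real) set" where
  "normalized_rank_one_convex =
     {f. (\<forall>A\<in>cubeQ. 0 \<le> f A) \<and> (\<forall>A. A \<notin> cubeQ \<longrightarrow> f A = 0) \<and>
         (\<Sum>A\<in>cube_vertices. f A) = 1 \<and> rank_one_convex_on cubeQ f}"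

definition measure_support :: "'a::topological_space measure \<Rightarrow> 'a set" where
  "measure_support \<mu> = {x. \<forall>U. open U \<longrightarrow> x \<in> U \<longrightarrow> 0 < emeasure \<mu> U}"

text \<open>On Euclidean spaces every Borel probability measure is Radon.\<close>

definition borel_prob :: "'a::euclidean_space measure \<Rightarrow> bool" where
  "borel_prob \<mu> \<longleftrightarrow> prob_space \<mu> \<and> sets \<mu> = sets borel"

definition barycentre :: "'a::euclidean_space measure \<Rightarrow> 'a" where
  "barycentre \<nu> = (\<integral>A. A \<partial>\<nu>)"

text \<open>The integrand may be defined only on \<open>Q\<close>, and a rank-one convex function on \<open>Q\<close> need not be
  Borel on the boundary of \<open>Q\<close>, in which case the Bochner integral over the whole space would be
  the default value 0. Integrating over the support, whose complement is a null set, avoids this: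
  rank-one convex functions are continuous in the interior of \<open>Q\<close>.\<close>

definition pairing :: "'a::euclidean_space measure \<Rightarrow> ('a \<Rightarrow> real) \<Rightarrow> real" where
  "pairing \<nu> g = (LINT A:measure_support \<nu>|\<nu>. g A)"

text \<open>The measure \<open>\<Sum>\<^sub>i \<lambda>\<^sub>i \<delta>\<^bsub>A\<^sub>i\<^esub>\<close> for the list of the pairs \<open>(\<lambda>\<^sub>i, A\<^sub>i)\<close>.\<close>

definition dirac_sum :: "(real \<times> 'a::euclidean_space) list \<Rightarrow> 'a measure" where
  "dirac_sum ws =
     distr (point_measure {..<length ws} (\<lambda>i. ennreal (fst (ws ! i)))) borel (\<lambda>i. snd (ws ! i))"

text \<open>The class consists of measures, not of lists, so in the splitting rule \<open>\<mu>\<close> may be written as a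
  weighted sum of Dirac masses in any order and with repetitions.\<close>

inductive finite_order_laminate :: "(real^'n^'n) measure \<Rightarrow> bool" where
  dirac: "finite_order_laminate (return borel A)"
| split: "finite_order_laminate \<mu> \<Longrightarrow> \<mu> = dirac_sum (ws @ [(l, A)]) \<Longrightarrow>
    (\<forall>(w, X) \<in> set ws. 0 \<le> w) \<Longrightarrow> 0 \<le> l \<Longrightarrow>
    A = s *\<^sub>R B + (1 - s) *\<^sub>R C \<Longrightarrow> 0 \<le> s \<Longrightarrow> s \<le> 1 \<Longrightarrow> rank (B - C) \<le> 1 \<Longrightarrow>
    finite_order_laminate (dirac_sum (ws @ [(l * s, B), (l * (1 - s), C)]))"

text \<open>Weak-* convergence in the dual of the space of continuous functions vanishing at infinity.\<close>

definition weak_star_limit :: "(nat \<Rightarrow> 'a::euclidean_space measure) \<Rightarrow> 'a measure \<Rightarrow> bool" where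
  "weak_star_limit \<mu> \<nu> \<longleftrightarrow>
     (\<forall>f :: 'a \<Rightarrow> real. continuous_on UNIV f \<and> (f \<longlongrightarrow> 0) at_infinity \<longrightarrow>
        (\<lambda>k. \<integral>A. f A \<partial>\<mu> k) \<longlonglongrightarrow> (\<integral>A. f A \<partial>\<nu>))"

definition laminate :: "(real^'n^'n) measure \<Rightarrow> bool" where
  "laminate \<nu> \<longleftrightarrow>
     borel_prob \<nu> \<and> compact (measure_support \<nu>) \<and>
     (\<exists>\<mu> K. compact K \<and>
        (\<forall>k. finite_order_laminate (\<mu> k) \<and> measure_support (\<mu> k) \<subseteq> K) \<and>
        weak_star_limit \<mu> \<nu>)"

end

theory Submission
  imports Defs
begin

text \<open>
  Call the set of normalized rank-one convex functions \<open>C\<close>.  Both directions pass through the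
  statement that \<open>f (barycentre \<nu>) \<le> pairing \<nu> f\<close> for all \<open>f \<in> C\<close>.

  This statement follows from the inequality for extreme points by Bauer's minimum principle
  (\<open>affine_attains_min_at_extreme_point\<close>) in the topology of pointwise convergence.  A rank-one
  convex function is convex in each matrix entry, so it is bounded on the cube by its values at
  the vertices; hence \<open>C\<close> is a closed subset of a product of intervals \<open>[0, 1]\<close>, which is compact by
  Tychonoff's theorem.  Separate convexity together with this bound also makes \<open>C\<close> equicontinuous on
  the support of \<open>\<nu>\<close>, a compact subset of the open cube.  Therefore \<open>pairing \<nu> f - f (barycentre \<nu>)\<close> is a
  continuous affine function of \<open>f \<in> C\<close>, and it attains its minimum at an extreme point
  (\<open>inequality_on_extreme_points_suffices\<close>).

  If \<open>\<nu>\<close> is a laminate, every \<open>f \<in> C\<close> coincides on the convex hull of the support with a continuous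
  function that is rank-one convex on the whole matrix space (\<open>rank_one_convex_extension\<close>).  For that
  function Jensen's inequality holds for finite-order laminates by induction on the splittings,
  and it passes to the weak-* limit (\<open>laminate_jensen\<close>).

  Conversely, assume the inequality for all of \<open>C\<close>.  The finite-order laminates obtained by splittings
  inside the cube are described by binary trees.  For a bounded Borel function \<open>f\<close> the infimum of the
  integrals of \<open>f\<close> over the trees with root \<open>A\<close> is a rank-one convex function of \<open>A\<close> below \<open>f\<close>.
  After adding a constant and rescaling it belongs to \<open>C\<close>, and the assumption yields trees with root
  \<open>barycentre \<nu>\<close> whose integral of \<open>f\<close> hardly exceeds that of \<open>\<nu>\<close> (\<open>splitting_tree_below_integral\<close>).  As the
  measures of these trees form a convex set, a separation argument in finite dimension
  (\<open>convex_set_approximates_point\<close>) shows that the integrals of finitely many functions can be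
  approximated simultaneously.  Applied to finer and finer partitions of unity this gives a
  sequence of finite-order laminates on the cube that converges to \<open>\<nu>\<close> (\<open>laminate_if_jensen\<close>).
\<close>

section \<open>Minima of affine functions and extreme points\<close>

text \<open>A point of an open segment where \<open>L\<close> is minimal forces \<open>L\<close> to be minimal at both ends, since an
  affine function cannot have the minimum of a segment in its interior only.\<close>

lemma face_of_minimizers:
  fixes L :: "'a::real_vector \<Rightarrow> real"
  assumes "convex C"
    and aff: "\<And>f g t. f \<in> C \<Longrightarrow> g \<in> C \<Longrightarrow> 0 \<le> t \<Longrightarrow> t \<le> 1 \<Longrightarrow>
      L ((1 - t) *\<^sub>R f + t *\<^sub>R g) = (1 - t) * L f + t * L g"
    and min: "\<And>f. f \<in> C \<Longrightarrow> m \<le> L f"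
  shows "{f \<in> C. L f = m} face_of C"
  unfolding face_of_def
proof (intro conjI ballI impI)
  show "convex {f \<in> C. L f = m}"
    unfolding convex_alt
  proof (intro ballI allI impI)
    fix f g and t :: real
    assume fg: "f \<in> {f \<in> C. L f = m}" "g \<in> {f \<in> C. L f = m}" and t: "0 \<le> t \<and> t \<le> 1"
    then have "(1 - t) *\<^sub>R f + t *\<^sub>R g \<in> C"
      using \<open>convex C\<close> by (auto simp: convex_alt)
    moreover have "L ((1 - t) *\<^sub>R f + t *\<^sub>R g) = m"
      using aff[of f g t] fg t by (simp add: left_diff_distrib)
    ultimately show "(1 - t) *\<^sub>R f + t *\<^sub>R g \<in> {f \<in> C. L f = m}"
      by simp
  qed
next
  fix a b x assume ab: "a \<in> C" "b \<in> C" and x: "x \<in> {f \<in> C. L f = m}" and "x \<in> open_segment a b"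
  then obtain t where t: "0 < t" "t < 1" and "x = (1 - t) *\<^sub>R a + t *\<^sub>R b"
    by (auto simp: in_segment)
  then have eq: "(1 - t) * (L a - m) + t * (L b - m) = 0"
    using aff[of a b t] ab x t by (auto simp: left_diff_distrib right_diff_distrib)
  have "0 \<le> (1 - t) * (L a - m)" "0 \<le> t * (L b - m)"
    using t min[OF ab(1)] min[OF ab(2)] by simp_all
  then have "(1 - t) * (L a - m) = 0" "t * (L b - m) = 0"
    using eq by linarith+
  then show "a \<in> {f \<in> C. L f = m}" "b \<in> {f \<in> C. L f = m}"
    using t ab by auto
qed auto

lemma obtain_face_of_minimizers:
  fixes C :: "'a::{real_vector, topological_space} set" and L :: "'a \<Rightarrow> real"
  assumes C: "compact C" "closed C" "convex C" "C \<noteq> {}" and L: "continuous_on C L"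
    and aff: "\<And>f g t. f \<in> C \<Longrightarrow> g \<in> C \<Longrightarrow> 0 \<le> t \<Longrightarrow> t \<le> 1 \<Longrightarrow>
      L ((1 - t) *\<^sub>R f + t *\<^sub>R g) = (1 - t) * L f + t * L g"
  obtains m where "closed {f \<in> C. L f = m}" "{f \<in> C. L f = m} \<noteq> {}"
    "{f \<in> C. L f = m} face_of C" "\<forall>f\<in>C. m \<le> L f"
proof -
  obtain f0 where f0: "f0 \<in> C" "\<And>f. f \<in> C \<Longrightarrow> L f0 \<le> L f"
    using continuous_attains_inf[OF C(1,4) L] by blast
  have "closed {f \<in> C. L f = L f0}"
    using continuous_closed_preimage[OF L C(2), of "{L f0}"]
    by (simp add: vimage_def Int_def)
  moreover have "{f \<in> C. L f = L f0} face_of C"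
    by (rule face_of_minimizers[OF C(3) aff f0(2)])
  ultimately show thesis
    using f0 by (intro that[of "L f0"]) auto
qed

text \<open>Zorn's lemma, with compactness providing nonempty intersections of chains.\<close>

lemma minimal_closed_face:
  fixes C :: "'a::{real_vector, topological_space} set"
  assumes "compact C" and F0: "closed F0" "F0 \<noteq> {}" "F0 face_of C"
  obtains M where "closed M" "M \<noteq> {}" "M face_of C" "M \<subseteq> F0"
    "\<forall>F. closed F \<and> F \<noteq> {} \<and> F face_of C \<and> F \<subseteq> M \<longrightarrow> F = M"
proof -
  define \<F> where "\<F> = {F. closed F \<and> F \<noteq> {} \<and> F face_of C \<and> F \<subseteq> F0}"
  have "\<exists>M\<in>\<F>. \<forall>X\<in>\<F>. X \<subseteq> M \<longrightarrow> X = M"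
  proof (rule predicate_Zorn)
    show "partial_order_on \<F> (relation_of (\<lambda>x y. y \<subseteq> x) \<F>)"
      by (rule partial_order_on_relation_ofI) auto
  next
    fix \<C> assume chain: "\<C> \<in> Chains (relation_of (\<lambda>x y. y \<subseteq> x) \<F>)"
    show "\<exists>u\<in>\<F>. \<forall>a\<in>\<C>. u \<subseteq> a"
    proof (cases "\<C> = {}")
      case True
      then show ?thesis using F0 by (auto simp: \<F>_def)
    next
      case False
      have sub: "\<C> \<subseteq> \<F>" and lin: "\<And>A B. A \<in> \<C> \<Longrightarrow> B \<in> \<C> \<Longrightarrow> A \<subseteq> B \<or> B \<subseteq> A"
        using chain by (auto simp: Chains_def relation_of_def)
      have cl: "closed A" and subC: "A \<subseteq> C" and ne: "A \<noteq> {}" and face: "A face_of C" and "A \<subseteq> F0"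
        if "A \<in> \<C>" for A
        using sub that face_of_imp_subset by (auto simp: \<F>_def)
      note props = this
      have "C \<inter> \<Inter>\<C> \<noteq> {}"
      proof (rule compact_imp_fip[OF \<open>compact C\<close> cl])
        fix \<B> assume \<B>: "finite \<B>" "\<B> \<subseteq> \<C>"
        have "\<exists>A\<in>\<C>. A \<subseteq> \<Inter>\<B>"
          using \<B>
        proof (induction \<B> rule: finite_induct)
          case empty
          then show ?case using False by auto
        next
          case (insert B \<B>)
          then obtain A where A: "A \<in> \<C>" "A \<subseteq> \<Inter>\<B>" by auto
          have B: "B \<in> \<C>" using insert.prems by simp
          from lin[OF A(1) B] show ?case
          proof
            assume "A \<subseteq> B"
            with A show ?thesis by (intro bexI[of _ A]) auto
          next
            assume "B \<subseteq> A"
            with A B show ?thesis by (intro bexI[of _ B]) auto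
          qed
        qed
        then obtain A where A: "A \<in> \<C>" "A \<subseteq> \<Inter>\<B>" by auto
        then obtain f where "f \<in> A"
          using ne[OF A(1)] by auto
        then have "f \<in> C \<inter> \<Inter>\<B>"
          using subC[OF A(1)] A(2) by auto
        then show "C \<inter> \<Inter>\<B> \<noteq> {}"
          by auto
      qed
      then have "\<Inter>\<C> \<noteq> {}" by blast
      moreover have "\<Inter>\<C> face_of C"
        using face False by (intro face_of_Inter) auto
      moreover have "closed (\<Inter>\<C>)"
        using cl by (intro closed_Inter) auto
      ultimately have "\<Inter>\<C> \<in> \<F>"
        using False props(5) by (auto simp: \<F>_def)
      then show ?thesis by blast
    qed
  qed
  then obtain M where M: "M \<in> \<F>" "\<And>X. X \<in> \<F> \<Longrightarrow> X \<subseteq> M \<Longrightarrow> X = M"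
    by blast
  show thesis
  proof (rule that)
    show "\<forall>F. closed F \<and> F \<noteq> {} \<and> F face_of C \<and> F \<subseteq> M \<longrightarrow> F = M"
      using M by (auto simp: \<F>_def)
  qed (use M(1) in \<open>auto simp: \<F>_def\<close>)
qed

text \<open>This is Bauer's minimum principle for the topology of pointwise convergence.  A closed face that is
  minimal among the closed faces inside the face of minimizers of \<open>L\<close> must be a single point,
  because otherwise some evaluation separates two of its points, and the minimizers of this
  evaluation form a smaller closed face; and a one-point face is an extreme point.\<close>

theorem affine_attains_min_at_extreme_point:
  fixes C :: "('a \<Rightarrow> real) set" and L :: "('a \<Rightarrow> real) \<Rightarrow> real"
  assumes C: "compact C" "closed C" "convex C" "C \<noteq> {}" and L: "continuous_on C L"
    and aff: "\<And>f g t. f \<in> C \<Longrightarrow> g \<in> C \<Longrightarrow> 0 \<le> t \<Longrightarrow> t \<le> 1 \<Longrightarrow>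
      L ((1 - t) *\<^sub>R f + t *\<^sub>R g) = (1 - t) * L f + t * L g"
  obtains g where "g extreme_point_of C" "\<And>f. f \<in> C \<Longrightarrow> L g \<le> L f"
proof -
  obtain m where F0: "closed {f \<in> C. L f = m}" "{f \<in> C. L f = m} \<noteq> {}"
    "{f \<in> C. L f = m} face_of C" and m: "\<forall>f\<in>C. m \<le> L f"
    by (rule obtain_face_of_minimizers[where L = L, OF C L aff])
  obtain M where M: "closed M" "M \<noteq> {}" "M face_of C" "M \<subseteq> {f \<in> C. L f = m}"
    and minimal: "\<forall>F. closed F \<and> F \<noteq> {} \<and> F face_of C \<and> F \<subseteq> M \<longrightarrow> F = M"
    by (rule minimal_closed_face[OF C(1) F0])
  have "M \<inter> C = M"
    using M(4) by auto
  then have M': "convex M" "compact M"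
    using face_of_imp_convex[OF M(3)] closed_Int_compact[OF M(1) C(1)] by auto
  obtain g where g: "g \<in> M"
    using M by blast
  have "M = {g}"
  proof (rule ccontr)
    assume "M \<noteq> {g}"
    then obtain h where "h \<in> M" "h \<noteq> g"
      using g by blast
    then obtain x where h: "h \<in> M" "h x \<noteq> g x"
      by (auto simp: fun_eq_iff)
    \<comment> \<open>Evaluation at \<open>x\<close> is not constant on \<open>M\<close>, so its minimizers form a smaller face.\<close>
    have "continuous_on M (\<lambda>f. f x)"
      by (rule continuous_on_subset[OF continuous_on_product_coordinates]) simp
    then obtain m' where m': "closed {f \<in> M. f x = m'}" "{f \<in> M. f x = m'} \<noteq> {}"
      "{f \<in> M. f x = m'} face_of M"
      by (rule obtain_face_of_minimizers[OF M'(2) M(1) M'(1) M(2), where L = "\<lambda>f. f x"])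
        (simp add: scaleR_fun_def)
    have "{f \<in> M. f x = m'} = M"
      using minimal[rule_format, of "{f \<in> M. f x = m'}"] m' face_of_trans[OF m'(3) M(3)] by simp
    then have "g x = m'" "h x = m'"
      using g h(1) by (metis (mono_tags, lifting) mem_Collect_eq)+
    then show False
      using h(2) by simp
  qed
  then have "g extreme_point_of C"
    using M(3) by (simp add: face_of_singleton)
  moreover have "L g = m"
    using M(4) g by auto
  ultimately show thesis
    using m that by blast
qed

section \<open>Separately convex functions\<close>

text \<open>A matrix with a single nonzero entry has rank one, so rank-one convex functions are convex along the
  segments in \<open>S\<close> that are parallel to a coordinate axis.  This alone entails their boundedness on the
  cube and their continuity.\<close>

definition coordinate_convex_on :: "'a::euclidean_space set \<Rightarrow> ('a \<Rightarrow> real) \<Rightarrow> bool" where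
  "coordinate_convex_on S f \<longleftrightarrow>
     (\<forall>b\<in>Basis. \<forall>p\<in>S. \<forall>t. p + t *\<^sub>R b \<in> S \<longrightarrow>
        (\<forall>s\<in>{0..1}. f (p + (s * t) *\<^sub>R b) \<le> (1 - s) * f p + s * f (p + t *\<^sub>R b)))"

text \<open>The slope of a convex function over an interval is at most its slope over any interval that follows
  it; here the second interval has length \<open>r\<close>, which leaves room for an increase of at most \<open>M\<close>.\<close>

lemma coordinate_convex_on_increment:
  fixes f :: "'a::euclidean_space \<Rightarrow> real"
  assumes conv: "coordinate_convex_on S f" and bd: "\<And>x. x \<in> S \<Longrightarrow> 0 \<le> f x \<and> f x \<le> M"
    and "0 < r" "b \<in> Basis" "p \<in> S" and z: "p + (d + r * sgn d) *\<^sub>R b \<in> S"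
  shows "f (p + d *\<^sub>R b) - f p \<le> M / r * \<bar>d\<bar>"
proof -
  \<comment> \<open>The middle point divides the prolonged segment in the ratio \<open>\<bar>d\<bar>\<close> to \<open>r\<close>.\<close>
  define s where "s = \<bar>d\<bar> / (\<bar>d\<bar> + r)"
  have s: "0 \<le> s" "s \<le> 1" and sr: "s \<le> \<bar>d\<bar> / r"
    using \<open>0 < r\<close> by (auto simp: s_def intro!: divide_left_mono)
  have "s * (d + r * sgn d) = d"
  proof -
    have "d + r * sgn d = sgn d * (\<bar>d\<bar> + r)"
      by (simp add: sgn_if)
    moreover have "\<bar>d\<bar> + r \<noteq> 0" using \<open>0 < r\<close> by linarith
    ultimately show ?thesis
      by (simp add: s_def sgn_if)
  qed
  then have "f (p + d *\<^sub>R b) \<le> (1 - s) * f p + s * f (p + (d + r * sgn d) *\<^sub>R b)"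
    using conv s assms(4-6) unfolding coordinate_convex_on_def by (metis atLeastAtMost_iff)
  also have "\<dots> \<le> f p + s * M"
  proof -
    have "s * f (p + (d + r * sgn d) *\<^sub>R b) \<le> s * M" "0 \<le> s * f p"
      using bd[OF z] bd[OF \<open>p \<in> S\<close>] s by (auto intro: mult_left_mono)
    then show ?thesis by (simp add: algebra_simps)
  qed
  also have "s * M \<le> \<bar>d\<bar> / r * M"
    using sr bd[OF \<open>p \<in> S\<close>] by (intro mult_right_mono) auto
  finally show ?thesis by (simp add: mult.commute)
qed

text \<open>The path from \<open>x\<close> to \<open>y\<close> that changes one coordinate at a time stays within distance \<open>r\<close> of \<open>x\<close> in
  every coordinate, so each step can be prolonged by \<open>r\<close> in both directions without leaving \<open>S\<close>.\<close>

lemma coordinate_convex_on_lipschitz: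
  fixes f :: "'a::euclidean_space \<Rightarrow> real"
  assumes conv: "coordinate_convex_on S f" and bd: "\<And>x. x \<in> S \<Longrightarrow> 0 \<le> f x \<and> f x \<le> M"
    and "0 < r" and S: "{z. \<forall>b\<in>Basis. \<bar>(z - x) \<bullet> b\<bar> \<le> 2 * r} \<subseteq> S"
    and y: "\<And>b. b \<in> Basis \<Longrightarrow> \<bar>(y - x) \<bullet> b\<bar> \<le> r"
  shows "\<bar>f y - f x\<bar> \<le> M / r * (\<Sum>b\<in>Basis. \<bar>(y - x) \<bullet> b\<bar>)"
proof -
  define z where "z F = x + (\<Sum>b\<in>F. ((y - x) \<bullet> b) *\<^sub>R b)" for F
  have "\<bar>f (z F) - f x\<bar> \<le> M / r * (\<Sum>b\<in>F. \<bar>(y - x) \<bullet> b\<bar>)" if "finite F" "F \<subseteq> Basis" for F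
    using that
  proof (induction F rule: finite_induct)
    case empty
    then show ?case by (simp add: z_def)
  next
    case (insert b F)
    define d where "d = (y - x) \<bullet> b"
    have b: "b \<in> Basis" and F: "F \<subseteq> Basis" using insert by auto
    have zb: "z (insert b F) = z F + d *\<^sub>R b"
      using insert by (simp add: z_def d_def)
    have coord: "(z F - x) \<bullet> c = (if c \<in> F then (y - x) \<bullet> c else 0)" if "c \<in> Basis" for c
    proof -
      have "(z F - x) \<bullet> c = (\<Sum>b\<in>F. ((y - x) \<bullet> b) * (b \<bullet> c))"
        by (simp add: z_def inner_sum_left)
      also have "\<dots> = (\<Sum>b\<in>F. if b = c then (y - x) \<bullet> c else 0)"
        using F that by (intro sum.cong refl) (auto simp: inner_Basis)
      finally show ?thesis
        using insert by (simp add: if_distrib)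
    qed
    have inS: "z F + e *\<^sub>R b \<in> S" if "\<bar>e\<bar> \<le> 2 * r" for e
    proof (rule subsetD[OF S], safe)
      fix c :: 'a assume c: "c \<in> Basis"
      have "(z F + e *\<^sub>R b - x) \<bullet> c = (z F - x) \<bullet> c + e * (b \<bullet> c)"
        by (simp add: algebra_simps)
      then show "\<bar>(z F + e *\<^sub>R b - x) \<bullet> c\<bar> \<le> 2 * r"
        using coord[OF c] y[OF c] that b c insert(2) \<open>0 < r\<close> by (auto simp: inner_Basis)
    qed
    have d: "\<bar>d\<bar> \<le> r" using y[OF b] by (simp add: d_def)
    have e1: "\<bar>d + r * sgn d\<bar> \<le> 2 * r" "\<bar>d\<bar> \<le> 2 * r" "\<bar>- r * sgn d\<bar> \<le> 2 * r"
      using d \<open>0 < r\<close> by (auto simp: sgn_if abs_if split: if_splits)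
    have "f (z F + d *\<^sub>R b) - f (z F) \<le> M / r * \<bar>d\<bar>"
      using inS[of 0] inS[OF e1(1)] \<open>0 < r\<close> b
      by (intro coordinate_convex_on_increment[OF conv bd]) auto
    moreover have "f ((z F + d *\<^sub>R b) + (- d) *\<^sub>R b) - f (z F + d *\<^sub>R b) \<le> M / r * \<bar>- d\<bar>"
    proof (rule coordinate_convex_on_increment[OF conv bd \<open>0 < r\<close> b inS[OF e1(2)]])
      have "z F + d *\<^sub>R b + (- d + r * sgn (- d)) *\<^sub>R b = z F + (- r * sgn d) *\<^sub>R b"
        by (simp only: add.assoc flip: scaleR_add_left) (simp add: sgn_minus)
      then show "z F + d *\<^sub>R b + (- d + r * sgn (- d)) *\<^sub>R b \<in> S"
        using inS[OF e1(3)] by (simp only:)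
    qed
    ultimately have "\<bar>f (z (insert b F)) - f (z F)\<bar> \<le> M / r * \<bar>d\<bar>"
      unfolding zb by (simp add: abs_le_iff)
    moreover have "(\<Sum>b\<in>insert b F. \<bar>(y - x) \<bullet> b\<bar>) = \<bar>d\<bar> + (\<Sum>b\<in>F. \<bar>(y - x) \<bullet> b\<bar>)"
      using insert by (simp add: d_def)
    ultimately show ?case
      using insert.IH[OF F] by (simp add: distrib_left)
  qed
  from this[of Basis] show ?thesis
    by (simp add: z_def euclidean_representation)
qed

lemma coordinate_box_subset_cball:
  fixes x :: "'a::euclidean_space"
  shows "{z. \<forall>b\<in>Basis. \<bar>(z - x) \<bullet> b\<bar> \<le> r} \<subseteq> cball x (r * DIM('a))"
proof safe
  fix z assume z: "\<forall>b\<in>Basis. \<bar>(z - x) \<bullet> b\<bar> \<le> r"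
  have "norm (z - x) \<le> (\<Sum>b\<in>Basis. \<bar>(z - x) \<bullet> b\<bar>)" by (rule norm_le_l1)
  also have "\<dots> \<le> (\<Sum>b\<in>(Basis :: 'a set). r)" using z by (intro sum_mono) auto
  also have "\<dots> = r * DIM('a)" by simp
  finally show "z \<in> cball x (r * DIM('a))" by (simp add: dist_norm norm_minus_commute)
qed

lemma coordinate_convex_on_isCont:
  fixes f :: "'a::euclidean_space \<Rightarrow> real"
  assumes conv: "coordinate_convex_on S f" and bd: "\<And>x. x \<in> S \<Longrightarrow> 0 \<le> f x \<and> f x \<le> M"
    and x: "x \<in> interior S"
  shows "isCont f x"
proof -
  obtain e where e: "0 < e" "cball x e \<subseteq> S"
    using x by (auto simp: mem_interior_cball)
  define r where "r = e / (2 * DIM('a))"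
  have r: "0 < r" using e by (simp add: r_def)
  have S: "{z. \<forall>b\<in>Basis. \<bar>(z - x) \<bullet> b\<bar> \<le> 2 * r} \<subseteq> S"
    using coordinate_box_subset_cball[of x "2 * r"] e(2) by (simp add: r_def)
  have ev: "\<forall>\<^sub>F y in at x. norm (f y - f x) \<le> M / r * (\<Sum>b\<in>Basis. \<bar>(y - x) \<bullet> b\<bar>)"
    unfolding eventually_at
  proof (intro exI[of _ r] conjI r ballI impI)
    fix y assume "y \<noteq> x \<and> dist y x < r"
    then have "\<bar>(y - x) \<bullet> b\<bar> \<le> r" if "b \<in> Basis" for b
      using Basis_le_norm[OF that, of "y - x"] by (simp add: dist_norm)
    from coordinate_convex_on_lipschitz[OF conv bd r S this]
    show "norm (f y - f x) \<le> M / r * (\<Sum>b\<in>Basis. \<bar>(y - x) \<bullet> b\<bar>)" by simp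
  qed
  have "((\<lambda>y. M / r * (\<Sum>b\<in>Basis. \<bar>(y - x) \<bullet> b\<bar>)) \<longlongrightarrow> M / r * (\<Sum>b\<in>Basis. \<bar>(x - x) \<bullet> b\<bar>)) (at x)"
    by (intro tendsto_intros)
  then have "((\<lambda>y. M / r * (\<Sum>b\<in>Basis. \<bar>(y - x) \<bullet> b\<bar>)) \<longlongrightarrow> 0) (at x)"
    by simp
  with ev have "((\<lambda>y. f y - f x) \<longlongrightarrow> 0) (at x)"
    by (rule Lim_null_comparison)
  then show ?thesis
    unfolding isCont_def by (rule LIM_zero_cancel)
qed

text \<open>The modulus \<open>\<delta>\<close> does not depend on the function.  This is what turns pointwise convergence of
  rank-one convex functions into uniform convergence on compact subsets of the interior.\<close>

lemma coordinate_convex_on_uniformly_equicontinuous: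
  fixes K :: "'a::euclidean_space set"
  assumes "compact K" "K \<subseteq> interior S" "0 < \<epsilon>"
  obtains \<delta> where "0 < \<delta>"
    "\<And>f x y. coordinate_convex_on S f \<Longrightarrow> (\<And>x. x \<in> S \<Longrightarrow> 0 \<le> f x \<and> f x \<le> M) \<Longrightarrow>
      x \<in> K \<Longrightarrow> y \<in> K \<Longrightarrow> dist x y < \<delta> \<Longrightarrow> \<bar>f y - f x\<bar> < \<epsilon>"
proof -
  obtain e where e: "0 < e" "(\<Union>x\<in>K. cball x e) \<subseteq> interior S"
    using compact_subset_open_imp_cball_epsilon_subset[OF assms(1) open_interior assms(2)] by blast
  define r where "r = e / (2 * DIM('a))"
  have r: "0 < r" using e by (simp add: r_def)
  have S: "{z. \<forall>b\<in>Basis. \<bar>(z - x) \<bullet> b\<bar> \<le> 2 * r} \<subseteq> S" if "x \<in> K" for x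
  proof -
    have "cball x e \<subseteq> S"
      using e(2) that interior_subset by blast
    then show ?thesis
      using coordinate_box_subset_cball[of x "2 * r"] by (simp add: r_def)
  qed
  \<comment> \<open>The modulus of the Lipschitz estimate, which is valid up to distance \<open>r\<close>; \<open>\<bar>M\<bar> + 1\<close> is a positive
    bound for \<open>M\<close>.\<close>
  define \<delta> where "\<delta> = min r (\<epsilon> * r / (DIM('a) * (\<bar>M\<bar> + 1)))"
  show thesis
  proof (rule that[of \<delta>])
    show "0 < \<delta>" using r \<open>0 < \<epsilon>\<close> by (simp add: \<delta>_def)
    fix f x y
    assume f: "coordinate_convex_on S f" "\<And>x. x \<in> S \<Longrightarrow> 0 \<le> f x \<and> f x \<le> M"
      and xy: "x \<in> K" "y \<in> K" "dist x y < \<delta>"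
    have b: "\<bar>(y - x) \<bullet> b\<bar> \<le> dist x y" if "b \<in> Basis" for b
      using Basis_le_norm[OF that, of "y - x"] by (simp add: dist_norm norm_minus_commute)
    have "x \<in> S" using S[OF xy(1)] r by auto
    then have M: "0 \<le> M" using f(2)[of x] by linarith
    have "\<bar>f y - f x\<bar> \<le> M / r * (\<Sum>b\<in>Basis. \<bar>(y - x) \<bullet> b\<bar>)"
      using b xy by (intro coordinate_convex_on_lipschitz[OF f r S]) (force simp: \<delta>_def)+
    also have "\<dots> \<le> M / r * (\<Sum>b\<in>(Basis :: 'a set). dist x y)"
      using M r b by (intro mult_left_mono sum_mono) auto
    also have "\<dots> \<le> (M + 1) / r * (DIM('a) * dist x y)"
      using M r by (simp add: divide_right_mono mult_right_mono)
    also have "\<dots> < (M + 1) / r * (DIM('a) * (\<epsilon> * r / (DIM('a) * (\<bar>M\<bar> + 1))))"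
      using M r xy by (intro mult_strict_left_mono) (auto simp: \<delta>_def)
    also have "\<dots> = \<epsilon>"
      using M r by simp
    finally show "\<bar>f y - f x\<bar> < \<epsilon>" .
  qed
qed

section \<open>The set of normalized rank-one convex functions\<close>

lemma rank_scaleR_Basis_le_1:
  fixes b :: "real^'n^'m"
  assumes "b \<in> Basis"
  shows "rank (t *\<^sub>R b) \<le> 1"
proof -
  obtain i u where b: "b = axis i u"
    using assms by (auto simp: Basis_vec_def)
  have "rows (t *\<^sub>R b) \<subseteq> span {u}"
    by (auto simp: rows_def row_def b axis_def span_singleton vec_eq_iff)
  then have "dim (rows (t *\<^sub>R b)) \<le> card {u}"
    by (intro dim_le_card) auto
  then show ?thesis by (simp add: row_rank_def)
qed

lemma rank_one_convex_on_imp_coordinate_convex_on: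
  fixes S :: "(real^'n^'n) set"
  assumes "rank_one_convex_on S f"
  shows "coordinate_convex_on S f"
  unfolding coordinate_convex_on_def
proof (intro ballI allI impI)
  fix b p :: "real^'n^'n" and t s :: real
  assume b: "b \<in> Basis" and pS: "p \<in> S" "p + t *\<^sub>R b \<in> S" and s: "s \<in> {0..1}"
  have "rank (p + t *\<^sub>R b - p) \<le> 1"
    using rank_scaleR_Basis_le_1[OF b] by simp
  then have "f (s *\<^sub>R (p + t *\<^sub>R b) + (1 - s) *\<^sub>R p) \<le> s * f (p + t *\<^sub>R b) + (1 - s) * f p"
    using assms pS s unfolding rank_one_convex_on_def by blast
  then show "f (p + (s * t) *\<^sub>R b) \<le> (1 - s) * f p + s * f (p + t *\<^sub>R b)"
    by (simp add: algebra_simps)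
qed

lemma Basis_matrix: "(Basis :: (real^'n^'m) set) = range (\<lambda>(i, j). axis i (axis j 1))"
  by (auto simp: Basis_vec_def)

lemma cubeQ_eq_cbox: "(cubeQ :: (real^'n^'n) set) = cbox 0 One"
proof -
  have "cbox 0 One = {A :: real^'n^'n. \<forall>b\<in>Basis. 0 \<le> A \<bullet> b \<and> A \<bullet> b \<le> 1}"
    by (auto simp: mem_box)
  then show ?thesis
    by (auto simp: cubeQ_def Basis_matrix inner_axis)
qed

lemma cube_vertices_eq: "(cube_vertices :: (real^'n^'n) set) = {A. \<forall>b\<in>Basis. A \<bullet> b \<in> {0, 1}}"
  by (auto simp: cube_vertices_def Basis_matrix inner_axis)

lemma compact_cubeQ: "compact (cubeQ :: (real^'n^'n) set)"
  and convex_cubeQ: "convex (cubeQ :: (real^'n^'n) set)"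
  by (simp_all add: cubeQ_eq_cbox)

lemma cube_vertices_subset: "(cube_vertices :: (real^'n^'n) set) \<subseteq> cubeQ"
proof
  fix A :: "real^'n^'n" assume "A \<in> cube_vertices"
  then have 01: "A $ i $ j = 0 \<or> A $ i $ j = 1" for i j
    by (simp add: cube_vertices_def)
  have "0 \<le> A $ i $ j \<and> A $ i $ j \<le> 1" for i j
    using 01[of i j] by auto
  then show "A \<in> cubeQ"
    by (simp add: cubeQ_def)
qed

text \<open>Replacing the coordinates by 0 or 1 one after the other expresses \<open>A\<close> as an iterated convex
  combination of vertices; the induction is on the set of coordinates that are neither 0 nor 1.\<close>

lemma coordinate_convex_on_cubeQ_le:
  fixes A :: "real^'n^'n"
  assumes conv: "coordinate_convex_on cubeQ f" and vert: "\<And>A. A \<in> cube_vertices \<Longrightarrow> f A \<le> M"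
    and A: "A \<in> cubeQ"
  shows "f A \<le> M"
proof -
  have "f A \<le> M" if "finite F" "A \<in> cubeQ" "{b\<in>Basis. A \<bullet> b \<notin> {0, 1}} \<subseteq> F" for F and A :: "real^'n^'n"
    using that
  proof (induction F arbitrary: A rule: finite_induct)
    case empty
    then show ?case by (intro vert) (auto simp: cube_vertices_eq)
  next
    case (insert b F)
    show ?case
    proof (cases "b \<in> Basis")
      case False
      then show ?thesis using insert.prems by (intro insert.IH) auto
    next
      case True
      define t where "t = A \<bullet> b"
      define p where "p = A - t *\<^sub>R b"
      have t: "t \<in> {0..1}"
        using insert.prems True by (auto simp: cubeQ_eq_cbox mem_box t_def)
      have coord: "p \<bullet> c = (if c = b then 0 else A \<bullet> c)"
        "(p + 1 *\<^sub>R b) \<bullet> c = (if c = b then 1 else A \<bullet> c)" if "c \<in> Basis" for c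
        using that True by (auto simp: p_def t_def algebra_simps inner_Basis)
      have inQ: "p \<in> cubeQ" "p + 1 *\<^sub>R b \<in> cubeQ"
        using insert.prems(1) coord by (auto simp: cubeQ_eq_cbox mem_box split: if_splits)
      have "f p \<le> M" "f (p + 1 *\<^sub>R b) \<le> M"
        using inQ coord insert.prems(2) by (auto intro!: insert.IH split: if_splits)
      moreover have "f (p + (t * 1) *\<^sub>R b) \<le> (1 - t) * f p + t * f (p + 1 *\<^sub>R b)"
        using conv True inQ t unfolding coordinate_convex_on_def by blast
      moreover have "p + (t * 1) *\<^sub>R b = A"
        by (simp add: p_def)
      ultimately show ?thesis
        using t convex_bound_le[of "f p" M "f (p + 1 *\<^sub>R b)" "1 - t" t] by simp
    qed
  qed
  from this[of Basis A] A show ?thesis by auto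
qed

lemma normalized_rank_one_convex_bounds:
  fixes f :: "real^'n^'n \<Rightarrow> real"
  assumes "f \<in> normalized_rank_one_convex" "A \<in> cubeQ"
  shows "0 \<le> f A \<and> f A \<le> 1"
proof
  show "0 \<le> f A" using assms by (auto simp: normalized_rank_one_convex_def)
  show "f A \<le> 1"
  proof (rule coordinate_convex_on_cubeQ_le)
    show "coordinate_convex_on cubeQ f"
      using assms(1) by (intro rank_one_convex_on_imp_coordinate_convex_on)
        (simp add: normalized_rank_one_convex_def)
    fix B :: "real^'n^'n" assume B: "B \<in> cube_vertices"
    have "f B \<le> (\<Sum>A\<in>cube_vertices. f A)"
      using assms(1) B cube_vertices_subset finite_cube_vertices
      by (intro member_le_sum) (auto simp: normalized_rank_one_convex_def)
    then show "f B \<le> 1"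
      using assms(1) by (simp add: normalized_rank_one_convex_def)
  qed (rule assms(2))
qed

text \<open>Each defining condition is a weak inequality or an equation between finitely many values of the
  function, and evaluations are continuous.\<close>

lemma closed_normalized_rank_one_convex:
  "closed (normalized_rank_one_convex :: (real^'n^'n \<Rightarrow> real) set)"
  unfolding normalized_rank_one_convex_def rank_one_convex_on_def Ball_def
  by (intro closed_Collect_conj closed_Collect_all closed_Collect_imp open_Collect_const
      closed_Collect_le closed_Collect_eq continuous_intros continuous_on_product_coordinates)

lemma compact_normalized_rank_one_convex:
  "compact (normalized_rank_one_convex :: (real^'n^'n \<Rightarrow> real) set)"
proof -
  have "compactin (product_topology (\<lambda>i. euclidean) UNIV) (PiE UNIV (\<lambda>_::real^'n^'n. {0..1::real}))"
    by (simp add: compactin_PiE)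
  then have "compact (PiE UNIV (\<lambda>_::real^'n^'n. {0..1::real}))"
    by (simp add: euclidean_product_topology)
  moreover have "normalized_rank_one_convex \<subseteq> PiE UNIV (\<lambda>_::real^'n^'n. {0..1::real})"
  proof (auto simp: PiE_def)
    fix f :: "real^'n^'n \<Rightarrow> real" and A assume f: "f \<in> normalized_rank_one_convex"
    have "A \<notin> cubeQ \<Longrightarrow> f A = 0" using f by (simp add: normalized_rank_one_convex_def)
    then show "0 \<le> f A" "f A \<le> 1"
      using normalized_rank_one_convex_bounds[OF f, of A] by (cases "A \<in> cubeQ"; simp)+
  qed
  ultimately show ?thesis
    using closed_Int_compact[OF closed_normalized_rank_one_convex] by (metis Int_absorb2)
qed

lemma convex_normalized_rank_one_convex:
  "convex (normalized_rank_one_convex :: (real^'n^'n \<Rightarrow> real) set)"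
  unfolding convex_alt
proof (intro ballI allI impI)
  fix f g :: "real^'n^'n \<Rightarrow> real" and t :: real
  assume f: "f \<in> normalized_rank_one_convex" and g: "g \<in> normalized_rank_one_convex"
    and t: "0 \<le> t \<and> t \<le> 1"
  have "rank_one_convex_on cubeQ (\<lambda>A. (1 - t) * f A + t * g A)"
    unfolding rank_one_convex_on_def
  proof (intro ballI impI)
    fix A B :: "real^'n^'n" and s :: real
    assume *: "A \<in> cubeQ" "B \<in> cubeQ" "s \<in> {0..1}" "rank (A - B) \<le> 1"
    let ?P = "s *\<^sub>R A + (1 - s) *\<^sub>R B"
    have "f ?P \<le> s * f A + (1 - s) * f B" "g ?P \<le> s * g A + (1 - s) * g B"
      using f g * by (auto simp: normalized_rank_one_convex_def rank_one_convex_on_def)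
    then have "(1 - t) * f ?P \<le> (1 - t) * (s * f A + (1 - s) * f B)"
      "t * g ?P \<le> t * (s * g A + (1 - s) * g B)"
      using t by (auto intro: mult_left_mono)
    then show "(1 - t) * f ?P + t * g ?P \<le> s * ((1 - t) * f A + t * g A) + (1 - s) * ((1 - t) * f B + t * g B)"
      by (simp add: algebra_simps)
  qed
  moreover have "(\<Sum>A\<in>cube_vertices. (1 - t) * f A + t * g A) = 1"
    using f g by (simp add: normalized_rank_one_convex_def sum.distrib flip: sum_distrib_left)
  ultimately have "(\<lambda>A. (1 - t) * f A + t * g A) \<in> normalized_rank_one_convex"
    using f g t by (auto simp: normalized_rank_one_convex_def)
  then show "(1 - t) *\<^sub>R f + t *\<^sub>R g \<in> normalized_rank_one_convex"
    by (simp add: scaleR_fun_def plus_fun_def)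
qed

section \<open>Supports and barycentres\<close>

lemma closed_measure_support: "closed (measure_support \<mu>)"
proof -
  have "open (- measure_support \<mu>)"
  proof (subst open_subopen, rule ballI)
    fix x assume "x \<in> - measure_support \<mu>"
    then obtain U where U: "open U" "x \<in> U" "\<not> 0 < emeasure \<mu> U"
      unfolding measure_support_def by blast
    then have "U \<subseteq> - measure_support \<mu>"
      unfolding measure_support_def by blast
    with U show "\<exists>T. open T \<and> x \<in> T \<and> T \<subseteq> - measure_support \<mu>"
      by blast
  qed
  then show ?thesis by (simp add: closed_def)
qed

text \<open>The complement of the support is a union of open null sets, and countably many of them suffice
  because the space is second countable.\<close>

lemma AE_in_measure_support:
  fixes \<mu> :: "'a::second_countable_topology measure"
  assumes "sets \<mu> = sets borel"
  shows "AE x in \<mu>. x \<in> measure_support \<mu>"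
proof -
  define \<N> where "\<N> = {U. open U \<and> emeasure \<mu> U = 0}"
  obtain \<U> where \<U>: "\<U> \<subseteq> \<N>" "countable \<U>" "\<Union>\<U> = \<Union>\<N>"
    by (rule Lindelof[of \<N>]) (simp add: \<N>_def)
  have "\<Union>\<U> \<in> null_sets \<mu>"
  proof (rule null_sets_UN'[of \<U> "\<lambda>U. U", simplified])
    show "U \<in> null_sets \<mu>" if "U \<in> \<U>" for U
      using \<U>(1) that assms by (auto simp: \<N>_def null_sets_def)
  qed (rule \<U>(2))
  moreover have "{x \<in> space \<mu>. x \<notin> measure_support \<mu>} \<subseteq> \<Union>\<U>"
  proof
    fix x assume "x \<in> {x \<in> space \<mu>. x \<notin> measure_support \<mu>}"
    then obtain U where "open U" "x \<in> U" "\<not> 0 < emeasure \<mu> U"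
      unfolding measure_support_def by blast
    then show "x \<in> \<Union>\<U>"
      unfolding \<U>(3) \<N>_def by auto
  qed
  ultimately show ?thesis
    by (rule AE_I')
qed

lemma compact_measure_support_in_cubeQ:
  fixes \<nu> :: "(real^'n^'n) measure"
  assumes "measure_support \<nu> \<subseteq> interior cubeQ"
  shows "compact (measure_support \<nu>)"
  using closed_measure_support compact_imp_bounded[OF compact_cubeQ] assms interior_subset
  by (metis bounded_subset compact_eq_bounded_closed)

lemma set_integrable_continuous_on_compact:
  fixes f :: "'a::euclidean_space \<Rightarrow> 'b::euclidean_space"
  assumes "finite_measure \<mu>" "sets \<mu> = sets borel" "compact K" "continuous_on K f"
  shows "set_integrable \<mu> K f"
proof -
  interpret finite_measure \<mu> by fact
  have K: "K \<in> sets borel" using assms(3) by (simp add: compact_imp_closed)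
  obtain B where B: "0 < B" "\<And>x. x \<in> K \<Longrightarrow> norm (f x) \<le> B"
    using compact_imp_bounded[OF compact_continuous_image[OF assms(4,3)]] by (auto simp: bounded_pos)
  have "(\<lambda>x. indicator K x *\<^sub>R f x) \<in> borel_measurable \<mu>"
    using borel_measurable_continuous_on_indicator[OF K assms(4)] assms(2)
    by (simp cong: measurable_cong_sets)
  then show ?thesis
    unfolding set_integrable_def
    using B by (intro integrable_const_bound[where B = B] AE_I2) (auto simp: indicator_def)
qed

lemma integrable_continuous_AE_in_compact:
  fixes f :: "'a::euclidean_space \<Rightarrow> 'b::euclidean_space"
  assumes "finite_measure \<mu>" "sets \<mu> = sets borel" "compact K" "AE x in \<mu>. x \<in> K" "continuous_on UNIV f"
  shows "integrable \<mu> f"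
proof -
  have "set_integrable \<mu> K f"
    by (rule set_integrable_continuous_on_compact[OF assms(1-3) continuous_on_subset[OF assms(5)]]) simp
  moreover have "f \<in> borel_measurable \<mu>"
    using assms(2,5) by (simp add: borel_measurable_continuous_onI cong: measurable_cong_sets)
  ultimately show ?thesis
    unfolding set_integrable_def
    using assms(4) by (subst integrable_cong_AE[where g = "\<lambda>x. indicator K x *\<^sub>R f x"])
      (auto elim: eventually_mono)
qed

text \<open>A hyperplane that strictly separates a point from \<open>S\<close> also separates it from every average over \<open>S\<close>.\<close>

lemma barycentre_in_convex:
  fixes \<nu> :: "'a::euclidean_space measure"
  assumes "borel_prob \<nu>" "AE x in \<nu>. x \<in> S" "compact S" "convex S"
  shows "barycentre \<nu> \<in> S"
proof (rule ccontr)
  interpret prob_space \<nu> using assms(1) by (simp add: borel_prob_def)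
  have sets: "sets \<nu> = sets borel" using assms(1) by (simp add: borel_prob_def)
  have int: "integrable \<nu> (\<lambda>x. x)"
    by (rule integrable_continuous_AE_in_compact[OF finite_measure_axioms sets assms(3,2)])
      (rule continuous_on_id)
  assume "barycentre \<nu> \<notin> S"
  then obtain a b where ab: "a \<bullet> barycentre \<nu> < b" "\<forall>x\<in>S. b < a \<bullet> x"
    using separating_hyperplane_closed_point[OF assms(4) compact_imp_closed[OF assms(3)]] by blast
  have "b \<le> (\<integral>x. a \<bullet> x \<partial>\<nu>)"
    using assms(2) int by (intro integral_ge_const) (auto elim!: eventually_mono dest: ab(2)[rule_format])
  also have "\<dots> = a \<bullet> barycentre \<nu>"
    using int by (simp add: barycentre_def)
  finally show False using ab(1) by simp
qed

section \<open>From extreme points to all normalized rank-one convex functions\<close>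

lemma pairing_eq_integral:
  assumes "sets \<nu> = sets borel" "f \<in> borel_measurable borel" "\<And>x. x \<in> measure_support \<nu> \<Longrightarrow> g x = f x"
  shows "pairing \<nu> g = (\<integral>x. f x \<partial>\<nu>)"
proof -
  have "pairing \<nu> g = (\<integral>x. indicator (measure_support \<nu>) x *\<^sub>R f x \<partial>\<nu>)"
    unfolding pairing_def set_lebesgue_integral_def
    using assms(3) by (intro Bochner_Integration.integral_cong) (auto simp: indicator_def)
  also have "\<dots> = (\<integral>x. f x \<partial>\<nu>)"
  proof (rule integral_cong_AE)
    have "measure_support \<nu> \<in> sets \<nu>" using closed_measure_support[of \<nu>] assms(1) by auto
    moreover show "f \<in> borel_measurable \<nu>" using assms by (simp cong: measurable_cong_sets)
    ultimately show "(\<lambda>x. indicator (measure_support \<nu>) x *\<^sub>R f x) \<in> borel_measurable \<nu>"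
      by measurable
    show "AE x in \<nu>. indicator (measure_support \<nu>) x *\<^sub>R f x = f x"
      using AE_in_measure_support[OF assms(1)] by (auto elim: eventually_mono)
  qed
  finally show ?thesis .
qed

lemma normalized_rank_one_convex_imp_coordinate_convex_on:
  "f \<in> normalized_rank_one_convex \<Longrightarrow> coordinate_convex_on cubeQ f"
  by (rule rank_one_convex_on_imp_coordinate_convex_on) (simp add: normalized_rank_one_convex_def)

lemma normalized_rank_one_convex_continuous_on:
  assumes f: "f \<in> normalized_rank_one_convex" and "K \<subseteq> interior cubeQ"
  shows "continuous_on K f"
proof (rule continuous_at_imp_continuous_on, rule ballI)
  fix x assume "x \<in> K"
  then show "isCont f x"
    using assms(2)
    by (intro coordinate_convex_on_isCont[OF normalized_rank_one_convex_imp_coordinate_convex_on[OF f]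
          normalized_rank_one_convex_bounds[OF f]]) auto
qed

text \<open>On the compact support the functions in question are equicontinuous, so functions that are close at
  the points of a finite net are uniformly close there.\<close>

lemma continuous_on_pairing:
  fixes \<nu> :: "(real^'n^'n) measure"
  assumes "borel_prob \<nu>" "measure_support \<nu> \<subseteq> interior cubeQ"
  shows "continuous_on normalized_rank_one_convex (pairing \<nu>)"
  unfolding continuous_on_def tendsto_iff
proof (intro ballI allI impI)
  interpret prob_space \<nu> using assms(1) by (simp add: borel_prob_def)
  have sets: "sets \<nu> = sets borel" using assms(1) by (simp add: borel_prob_def)
  let ?C = "normalized_rank_one_convex :: (real^'n^'n \<Rightarrow> real) set"
  let ?K = "measure_support \<nu>"
  have K: "compact ?K"
    by (rule compact_measure_support_in_cubeQ[OF assms(2)])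
  fix f :: "real^'n^'n \<Rightarrow> real" and \<epsilon> :: real assume f: "f \<in> ?C" and "0 < \<epsilon>"
  obtain \<delta> where \<delta>: "0 < \<delta>" and equi: "\<And>f x y. coordinate_convex_on cubeQ f \<Longrightarrow>
      (\<And>x. x \<in> cubeQ \<Longrightarrow> 0 \<le> f x \<and> f x \<le> 1) \<Longrightarrow>
      x \<in> ?K \<Longrightarrow> y \<in> ?K \<Longrightarrow> dist x y < \<delta> \<Longrightarrow> \<bar>f y - f x\<bar> < \<epsilon> / 6"
    by (rule coordinate_convex_on_uniformly_equicontinuous[OF K assms(2), of "\<epsilon> / 6" 1])
      (use \<open>0 < \<epsilon>\<close> in simp, blast)
  have equi': "\<bar>g y - g x\<bar> < \<epsilon> / 6" if "g \<in> ?C" "x \<in> ?K" "y \<in> ?K" "dist x y < \<delta>" for g x y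
    by (rule equi[OF normalized_rank_one_convex_imp_coordinate_convex_on[OF that(1)]
          normalized_rank_one_convex_bounds[OF that(1)] that(2-4)])
  obtain Z where Z: "finite Z" "Z \<subseteq> ?K" "?K \<subseteq> (\<Union>z\<in>Z. ball z \<delta>)"
  proof (rule compactE_image[OF K, of ?K "\<lambda>x. ball x \<delta>"])
    show "?K \<subseteq> (\<Union>x\<in>?K. ball x \<delta>)" using \<delta> by force
  qed auto
  have "\<forall>\<^sub>F g in at f within ?C. \<forall>z\<in>Z. dist (g z) (f z) < \<epsilon> / 6"
  proof (rule eventually_ball_finite[OF Z(1)], rule ballI)
    fix z
    have "continuous_on ?C (\<lambda>g. g z)"
      by (rule continuous_on_subset[OF continuous_on_product_coordinates]) simp
    then have "((\<lambda>g. g z) \<longlongrightarrow> f z) (at f within ?C)"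
      using f by (simp add: continuous_on_def)
    then show "\<forall>\<^sub>F g in at f within ?C. dist (g z) (f z) < \<epsilon> / 6"
      by (rule tendstoD) (use \<open>0 < \<epsilon>\<close> in simp)
  qed
  moreover have "\<forall>\<^sub>F g in at f within ?C. g \<in> ?C"
    by (auto simp: eventually_at_filter)
  ultimately show "\<forall>\<^sub>F g in at f within ?C. dist (pairing \<nu> g) (pairing \<nu> f) < \<epsilon>"
  proof eventually_elim
    case (elim g)
    have close: "\<bar>g x - f x\<bar> \<le> \<epsilon> / 2" if x: "x \<in> ?K" for x
    proof -
      obtain z where z: "z \<in> Z" "dist z x < \<delta>" using Z(3) x by auto
      then have "\<bar>g x - g z\<bar> < \<epsilon> / 6" "\<bar>f x - f z\<bar> < \<epsilon> / 6" "\<bar>g z - f z\<bar> < \<epsilon> / 6"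
        using equi'[of g z x] equi'[of f z x] elim f x Z(2) by (auto simp: dist_real_def)
      then show ?thesis by linarith
    qed
    have int: "integrable \<nu> (\<lambda>x. indicator ?K x *\<^sub>R g x)" "integrable \<nu> (\<lambda>x. indicator ?K x *\<^sub>R f x)"
      using set_integrable_continuous_on_compact[OF finite_measure_axioms sets K] normalized_rank_one_convex_continuous_on
        elim f assms(2) unfolding set_integrable_def by blast+
    have "\<bar>pairing \<nu> g - pairing \<nu> f\<bar> = \<bar>\<integral>x. indicator ?K x *\<^sub>R g x - indicator ?K x *\<^sub>R f x \<partial>\<nu>\<bar>"
      using int by (simp add: pairing_def set_lebesgue_integral_def)
    also have "\<dots> \<le> (\<integral>x. \<bar>indicator ?K x *\<^sub>R g x - indicator ?K x *\<^sub>R f x\<bar> \<partial>\<nu>)"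
      by (rule integral_abs_bound)
    also have "\<dots> \<le> (\<integral>x. \<epsilon> / 2 \<partial>\<nu>)"
      using int close \<open>0 < \<epsilon>\<close> by (intro integral_mono) (auto simp: indicator_def)
    finally show ?case using \<open>0 < \<epsilon>\<close> by (simp add: dist_real_def prob_space)
  qed
qed

text \<open>The defect \<open>pairing \<nu> g - g (barycentre \<nu>)\<close> is affine and continuous in \<open>g\<close>, and so it is least at an
  extreme point.\<close>

theorem inequality_on_extreme_points_suffices:
  fixes \<nu> :: "(real^'n^'n) measure"
  assumes "borel_prob \<nu>" "measure_support \<nu> \<subseteq> interior cubeQ"
    and ext: "\<And>g. g extreme_point_of normalized_rank_one_convex \<Longrightarrow> g (barycentre \<nu>) \<le> pairing \<nu> g"
    and f: "f \<in> normalized_rank_one_convex"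
  shows "f (barycentre \<nu>) \<le> pairing \<nu> f"
proof -
  interpret prob_space \<nu> using assms(1) by (simp add: borel_prob_def)
  have sets: "sets \<nu> = sets borel" using assms(1) by (simp add: borel_prob_def)
  let ?C = "normalized_rank_one_convex :: (real^'n^'n \<Rightarrow> real) set"
  let ?K = "measure_support \<nu>"
  have K: "compact ?K"
    by (rule compact_measure_support_in_cubeQ[OF assms(2)])
  define L where "L g = pairing \<nu> g - g (barycentre \<nu>)" for g
  have "continuous_on ?C L"
    unfolding L_def
    by (intro continuous_on_diff continuous_on_pairing assms(1,2)
        continuous_on_subset[OF continuous_on_product_coordinates]) simp
  moreover have "L ((1 - t) *\<^sub>R g + t *\<^sub>R h) = (1 - t) * L g + t * L h" if "g \<in> ?C" "h \<in> ?C" for g h t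
  proof -
    have "set_integrable \<nu> ?K g" "set_integrable \<nu> ?K h"
      using set_integrable_continuous_on_compact[OF finite_measure_axioms sets K] normalized_rank_one_convex_continuous_on
        that assms(2) by blast+
    then have "pairing \<nu> ((1 - t) *\<^sub>R g + t *\<^sub>R h) = (1 - t) * pairing \<nu> g + t * pairing \<nu> h"
      by (simp add: pairing_def scaleR_fun_def plus_fun_def)
    then show ?thesis
      by (simp add: L_def scaleR_fun_def algebra_simps)
  qed
  moreover have "?C \<noteq> {}" using f by auto
  ultimately obtain g where "g extreme_point_of ?C" "\<And>f. f \<in> ?C \<Longrightarrow> L g \<le> L f"
    using affine_attains_min_at_extreme_point[where L = L, OF compact_normalized_rank_one_convex
        closed_normalized_rank_one_convex convex_normalized_rank_one_convex] by metis
  then show ?thesis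
    using ext[of g] f unfolding L_def by force
qed

section \<open>Sums of Dirac masses and finite-order laminates\<close>

lemma measurable_dirac_sum_locations:
  "(\<lambda>i. snd (ws ! i)) \<in> measurable (point_measure {..<length ws} p) borel"
  by (simp add: measurable_def space_point_measure sets_point_measure)

lemma sets_dirac_sum [simp]: "sets (dirac_sum ws) = sets borel"
  by (simp add: dirac_sum_def)

text \<open>This formula depends on the list only through its multiset, which gives invariance under
  permutations.\<close>

lemma emeasure_dirac_sum:
  assumes "X \<in> sets borel"
  shows "emeasure (dirac_sum ws) X = (\<Sum>(w, x)\<leftarrow>ws. ennreal w * indicator X x)"
proof -
  have "emeasure (dirac_sum ws) X
      = emeasure (point_measure {..<length ws} (\<lambda>i. ennreal (fst (ws ! i)))) ({i. snd (ws ! i) \<in> X} \<inter> {..<length ws})"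
    using assms unfolding dirac_sum_def
    by (simp add: emeasure_distr[OF measurable_dirac_sum_locations] space_point_measure vimage_def)
  also have "\<dots> = (\<Sum>i\<in>{i. snd (ws ! i) \<in> X} \<inter> {..<length ws}. ennreal (fst (ws ! i)))"
    by (rule emeasure_point_measure_finite) auto
  also have "\<dots> = (\<Sum>i<length ws. ennreal (fst (ws ! i)) * indicator X (snd (ws ! i)))"
    by (rule sum.mono_neutral_cong_left) (auto simp: indicator_def)
  also have "\<dots> = (\<Sum>(w, x)\<leftarrow>ws. ennreal w * indicator X x)"
    by (simp add: sum_list_sum_nth case_prod_beta atLeast0LessThan)
  finally show ?thesis .
qed

lemma dirac_sum_cong_mset:
  assumes "mset vs = mset ws"
  shows "dirac_sum vs = dirac_sum ws"
proof (rule measure_eqI)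
  fix X :: "'a set" assume "X \<in> sets (dirac_sum vs)"
  then have X: "X \<in> sets borel" by simp
  have "sum_mset (image_mset (\<lambda>(w, x). ennreal w * indicator X x) (mset vs))
      = sum_mset (image_mset (\<lambda>(w, x). ennreal w * indicator X x) (mset ws))"
    using assms by simp
  then have "(\<Sum>(w, x)\<leftarrow>vs. ennreal w * indicator X x) = (\<Sum>(w, x)\<leftarrow>ws. ennreal w * indicator X x)"
    by (simp only: sum_mset_sum_list flip: mset_map)
  then show "emeasure (dirac_sum vs) X = emeasure (dirac_sum ws) X"
    by (simp add: emeasure_dirac_sum[OF X])
qed simp

lemma return_eq_dirac_sum: "return borel A = dirac_sum [(1, A)]"
  by (rule measure_eqI) (simp_all add: emeasure_dirac_sum)

lemma
  fixes F :: "'a::euclidean_space \<Rightarrow> 'b::{banach, second_countable_topology}"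
  assumes w: "\<forall>(w, x)\<in>set ws. 0 \<le> w" and F: "F \<in> borel_measurable borel"
  shows integrable_dirac_sum: "integrable (dirac_sum ws) F"
    and integral_dirac_sum: "(\<integral>x. F x \<partial>dirac_sum ws) = (\<Sum>(w, x)\<leftarrow>ws. w *\<^sub>R F x)"
proof -
  show "integrable (dirac_sum ws) F"
    unfolding dirac_sum_def
    by (simp add: integrable_distr_eq[OF measurable_dirac_sum_locations F] integrable_point_measure_finite)
  have nonneg: "0 \<le> fst (ws ! i)" if "i < length ws" for i
    using w nth_mem[OF that] by (auto simp: case_prod_beta)
  have "(\<integral>x. F x \<partial>dirac_sum ws)
      = (\<integral>i. F (snd (ws ! i)) \<partial>point_measure {..<length ws} (\<lambda>i. ennreal (fst (ws ! i))))"
    unfolding dirac_sum_def by (rule integral_distr[OF measurable_dirac_sum_locations F])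
  also have "\<dots> = (\<Sum>i<length ws. fst (ws ! i) *\<^sub>R F (snd (ws ! i)))"
    by (rule lebesgue_integral_point_measure_finite) (auto simp: nonneg)
  finally show "(\<integral>x. F x \<partial>dirac_sum ws) = (\<Sum>(w, x)\<leftarrow>ws. w *\<^sub>R F x)"
    by (simp add: sum_list_sum_nth case_prod_beta atLeast0LessThan)
qed

lemma finite_order_laminate_dirac_sum:
  assumes "finite_order_laminate \<mu>"
  obtains ws where "\<mu> = dirac_sum ws" "\<forall>(w, x)\<in>set ws. 0 \<le> w"
  using assms
proof cases
  case (dirac A)
  then show ?thesis by (intro that[of "[(1, A)]"]) (auto simp: return_eq_dirac_sum)
next
  case (split \<mu> ws l A s B C)
  then show ?thesis by (intro that[of "ws @ [(l * s, B), (l * (1 - s), C)]"]) auto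
qed

text \<open>A splitting preserves the barycentre and does not decrease the integral of a rank-one convex
  function.\<close>

lemma finite_order_laminate_jensen:
  fixes G :: "real^'n^'n \<Rightarrow> real"
  assumes "finite_order_laminate \<mu>" and conv: "rank_one_convex_on UNIV G"
    and meas: "G \<in> borel_measurable borel"
  shows "G (barycentre \<mu>) \<le> (\<integral>A. G A \<partial>\<mu>)"
  using assms(1)
proof (induction rule: finite_order_laminate.induct)
  case (dirac A)
  then show ?case
    using meas by (simp add: return_eq_dirac_sum integral_dirac_sum barycentre_def)
next
  case (split \<mu> ws l A s B C)
  have G: "G A \<le> s * G B + (1 - s) * G C"
    using conv split unfolding rank_one_convex_on_def by auto
  have bary: "barycentre (dirac_sum (ws @ [(l * s, B), (l * (1 - s), C)])) = barycentre \<mu>"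
    using split by (simp add: barycentre_def integral_dirac_sum scaleR_add_right)
  have "(\<integral>A. G A \<partial>\<mu>) = (\<Sum>(w, x)\<leftarrow>ws. w * G x) + l * G A"
    using split meas by (simp add: integral_dirac_sum)
  also have "\<dots> \<le> (\<Sum>(w, x)\<leftarrow>ws. w * G x) + l * (s * G B + (1 - s) * G C)"
    using split G by (intro add_left_mono mult_left_mono)
  also have "\<dots> = (\<integral>A. G A \<partial>dirac_sum (ws @ [(l * s, B), (l * (1 - s), C)]))"
    using split meas by (subst integral_dirac_sum) (auto simp: distrib_left)
  finally show ?case
    using split.IH bary by simp
qed

section \<open>Extension to a globally rank-one convex function\<close>

lemma convex_combination_infdist_le:
  fixes H :: "'a::euclidean_space set"
  assumes "compact H" "convex H" "H \<noteq> {}" and t: "0 \<le> t" "t \<le> 1"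
  shows "infdist (t *\<^sub>R x + (1 - t) *\<^sub>R y) H \<le> t * infdist x H + (1 - t) * infdist y H"
proof -
  obtain a b where ab: "a \<in> H" "infdist x H = dist x a" "b \<in> H" "infdist y H = dist y b"
    using infdist_attains_inf[OF compact_imp_closed[OF assms(1)] assms(3)] by metis
  have "t *\<^sub>R a + (1 - t) *\<^sub>R b \<in> H"
    using convexD[OF assms(2) ab(1,3), of t "1 - t"] t by simp
  then have "infdist (t *\<^sub>R x + (1 - t) *\<^sub>R y) H \<le> norm (t *\<^sub>R x + (1 - t) *\<^sub>R y - (t *\<^sub>R a + (1 - t) *\<^sub>R b))"
    unfolding dist_norm[symmetric] by (rule infdist_le)
  also have "\<dots> = norm (t *\<^sub>R (x - a) + (1 - t) *\<^sub>R (y - b))"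
    by (simp add: algebra_simps)
  also have "\<dots> \<le> t * norm (x - a) + (1 - t) * norm (y - b)"
    using t by (intro norm_triangle_le) simp
  finally show ?thesis by (simp add: ab dist_norm)
qed

lemma rank_scaleR_le:
  fixes X :: "real^'n^'m"
  shows "rank (c *\<^sub>R X) \<le> rank X"
proof -
  have "c *\<^sub>R X = (c *\<^sub>R mat 1) ** X"
    by (simp add: scalar_matrix_assoc[symmetric])
  then show ?thesis by (metis rank_mul_le_right)
qed

text \<open>The convex function \<open>h\<close> dominates \<open>g\<close> on the part of \<open>S\<close> where \<open>h \<ge> 1\<close>, so that the maximum can be
  continued by \<open>h\<close>.  Convexity along a rank-one line is clear at points where the glued function is
  \<open>h\<close>.  At any other point \<open>P\<close> the inequality for \<open>g\<close> is used between two points of \<open>S\<close>, one on the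
  segment from \<open>P\<close> to \<open>A\<close> and one on the segment from \<open>P\<close> to \<open>B\<close>, where \<open>g\<close> is below the chord of the
  glued function; solving the result for the value at \<open>P\<close> gives the inequality between \<open>A\<close> and \<open>B\<close>.\<close>

lemma glue_rank_one_convex:
  fixes g h :: "real^'n^'n \<Rightarrow> real"
  assumes g: "rank_one_convex_on S g" and g1: "\<And>A. A \<in> S \<Longrightarrow> g A \<le> 1"
    and h: "\<And>A B t. 0 \<le> t \<Longrightarrow> t \<le> 1 \<Longrightarrow> h (t *\<^sub>R A + (1 - t) *\<^sub>R B) \<le> t * h A + (1 - t) * h B"
    and cont: "continuous_on UNIV h" and h1: "\<And>A. h A \<le> 1 \<Longrightarrow> A \<in> S"
  shows "rank_one_convex_on UNIV (\<lambda>A. if A \<in> S then max (g A) (h A) else h A)"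
    (is "rank_one_convex_on UNIV ?G")
  unfolding rank_one_convex_on_def
proof (intro ballI impI)
  fix A B :: "real^'n^'n" and t :: real
  assume t: "t \<in> {0..1}" and rank: "rank (A - B) \<le> 1"
  define P where "P = t *\<^sub>R A + (1 - t) *\<^sub>R B"
  have hG: "h X \<le> ?G X" for X by simp
  have gG: "g X \<le> ?G X" if "X \<in> S" for X using that by simp
  show "?G P \<le> t * ?G A + (1 - t) * ?G B"
  proof (cases "?G P = h P")
    case True
    have "h P \<le> t * h A + (1 - t) * h B"
      using h t by (simp add: P_def)
    also have "\<dots> \<le> t * ?G A + (1 - t) * ?G B"
      using t hG[of A] hG[of B] by (intro add_mono mult_left_mono) auto
    finally show ?thesis using True by simp
  next
    case False
    then have P: "P \<in> S" "h P < g P" and GP: "?G P = g P"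
      by (auto simp: max_def split: if_splits)
    \<comment> \<open>The point is \<open>X\<close> itself if \<open>X\<close> is in \<open>S\<close>, and otherwise a point where \<open>h = 1\<close>, which exists because
      \<open>h\<close> is below 1 at \<open>P\<close> and above 1 at \<open>X\<close>.\<close>
    have chord: "\<exists>s. 0 < s \<and> s \<le> 1 \<and> P + s *\<^sub>R (X - P) \<in> S \<and>
        g (P + s *\<^sub>R (X - P)) \<le> (1 - s) * ?G P + s * ?G X" for X
    proof (cases "X \<in> S")
      case True
      then show ?thesis using gG by (intro exI[of _ 1]) auto
    next
      case False
      then have "1 < h X" using h1[of X] by fastforce
      moreover have "h P < 1" using P g1[OF P(1)] by linarith
      moreover have "continuous_on {0..1} (\<lambda>s. h (P + s *\<^sub>R (X - P)))"
        by (rule continuous_on_compose2[OF cont]) (auto intro!: continuous_intros)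
      ultimately obtain s where s: "0 \<le> s" "s \<le> 1" "h (P + s *\<^sub>R (X - P)) = 1"
        using IVT'[of "\<lambda>s. h (P + s *\<^sub>R (X - P))" 0 1 1] by auto
      have "s \<noteq> 0" using s(3) \<open>h P < 1\<close> by auto
      have inS: "P + s *\<^sub>R (X - P) \<in> S" using s h1 by simp
      have "P + s *\<^sub>R (X - P) = s *\<^sub>R X + (1 - s) *\<^sub>R P" by (simp add: algebra_simps)
      then have "1 \<le> s * h X + (1 - s) * h P"
        using s h[of s X P] by simp
      also have "\<dots> \<le> s * ?G X + (1 - s) * ?G P"
        using s hG[of X] hG[of P] by (intro add_mono mult_left_mono) auto
      finally have "g (P + s *\<^sub>R (X - P)) \<le> (1 - s) * ?G P + s * ?G X"
        using g1[OF inS] by linarith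
      then show ?thesis using s inS \<open>s \<noteq> 0\<close> by (intro exI[of _ s]) auto
    qed
    obtain s where s: "0 < s" "s \<le> 1" "P + s *\<^sub>R (A - P) \<in> S"
      "g (P + s *\<^sub>R (A - P)) \<le> (1 - s) * ?G P + s * ?G A"
      using chord[of A] by blast
    obtain u where u: "0 < u" "u \<le> 1" "P + u *\<^sub>R (B - P) \<in> S"
      "g (P + u *\<^sub>R (B - P)) \<le> (1 - u) * ?G P + u * ?G B"
      using chord[of B] by blast
    \<comment> \<open>In units of \<open>A - B\<close> the two points lie at distances \<open>s * (1 - t)\<close> and \<open>u * t\<close> from \<open>P\<close> on opposite
      sides, so that \<open>\<tau>\<close> is the weight of the first one in \<open>P\<close>.\<close>
    define D where "D = s * (1 - t) + u * t"
    have "0 < D"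
      using s u t by (cases "t = 0") (auto simp: D_def intro!: add_nonneg_pos)
    define \<tau> where "\<tau> = u * t / D"
    have \<tau>: "\<tau> \<in> {0..1}" and \<tau>': "1 - \<tau> = s * (1 - t) / D"
      using \<open>0 < D\<close> s u t by (auto simp: \<tau>_def D_def field_simps)
    have AP: "A - P = (1 - t) *\<^sub>R (A - B)" and BP: "B - P = (- t) *\<^sub>R (A - B)"
      by (auto simp: P_def algebra_simps)
    have "\<tau> * (s * (1 - t)) + (1 - \<tau>) * (u * (- t)) = 0"
      unfolding \<tau>' by (simp add: \<tau>_def)
    then have PP: "\<tau> *\<^sub>R (P + s *\<^sub>R (A - P)) + (1 - \<tau>) *\<^sub>R (P + u *\<^sub>R (B - P)) = P"
    proof -
      assume z: "\<tau> * (s * (1 - t)) + (1 - \<tau>) * (u * (- t)) = 0"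
      have "\<tau> *\<^sub>R (P + s *\<^sub>R (A - P)) + (1 - \<tau>) *\<^sub>R (P + u *\<^sub>R (B - P))
          = P + (\<tau> * (s * (1 - t)) + (1 - \<tau>) * (u * (- t))) *\<^sub>R (A - B)"
        unfolding AP BP by (simp add: algebra_simps)
      then show ?thesis unfolding z by simp
    qed
    have "P + s *\<^sub>R (A - P) - (P + u *\<^sub>R (B - P)) = (s * (1 - t) + u * t) *\<^sub>R (A - B)"
      unfolding AP BP by (simp add: algebra_simps)
    then have "rank (P + s *\<^sub>R (A - P) - (P + u *\<^sub>R (B - P))) \<le> 1"
      using rank_scaleR_le[of "s * (1 - t) + u * t" "A - B"] rank by simp
    then have "g P \<le> \<tau> * g (P + s *\<^sub>R (A - P)) + (1 - \<tau>) * g (P + u *\<^sub>R (B - P))"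
      using g s(3) u(3) \<tau> PP unfolding rank_one_convex_on_def by metis
    also have "\<dots> \<le> \<tau> * ((1 - s) * ?G P + s * ?G A) + (1 - \<tau>) * ((1 - u) * ?G P + u * ?G B)"
      using \<tau> s(4) u(4) by (intro add_mono mult_left_mono) auto
    finally have "D * ?G P \<le> D * (\<tau> * ((1 - s) * ?G P + s * ?G A) + (1 - \<tau>) * ((1 - u) * ?G P + u * ?G B))"
      unfolding GP using \<open>0 < D\<close> by (intro mult_left_mono) auto
    also have "\<dots> = (D * \<tau>) * ((1 - s) * ?G P + s * ?G A) + (D * (1 - \<tau>)) * ((1 - u) * ?G P + u * ?G B)"
      by (simp add: distrib_left)
    also have "D * \<tau> = u * t" using \<open>0 < D\<close> by (simp add: \<tau>_def)
    also have "D * (1 - \<tau>) = s * (1 - t)" unfolding \<tau>' using \<open>0 < D\<close> by simp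
    finally have "D * ?G P \<le> u * t * ((1 - s) * ?G P + s * ?G A) + s * (1 - t) * ((1 - u) * ?G P + u * ?G B)" .
    then have "(u * s) * ?G P \<le> (u * s) * (t * ?G A + (1 - t) * ?G B)"
      unfolding D_def by (simp only: algebra_simps)
    then show ?thesis
      using s u by (simp only: mult_le_cancel_left_pos mult_pos_pos)
  qed
qed

text \<open>A laminate may be approximated by finite-order laminates that charge points outside the cube, about
  which \<open>g\<close> says nothing.  It is therefore glued to a multiple of the distance from \<open>H\<close>, which
  vanishes on \<open>H\<close> and exceeds the upper bound 1 of \<open>g\<close> before the boundary of the cube is reached.\<close>

lemma rank_one_convex_extension:
  fixes g :: "real^'n^'n \<Rightarrow> real"
  assumes g: "g \<in> normalized_rank_one_convex"
    and H: "compact H" "convex H" "H \<noteq> {}" "H \<subseteq> interior cubeQ"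
  obtains G where "rank_one_convex_on UNIV G" "continuous_on UNIV G" "\<forall>A\<in>H. G A = g A"
proof -
  obtain \<delta> where \<delta>: "0 < \<delta>" "(\<Union>A\<in>H. cball A \<delta>) \<subseteq> interior cubeQ"
    using compact_subset_open_imp_cball_epsilon_subset[OF H(1) open_interior H(4)] by blast
  define h where "h A = infdist A H / \<delta>" for A
  define G where "G A = (if A \<in> cubeQ then max (g A) (h A) else h A)" for A
  have h0: "0 \<le> h A" for A
    using \<delta> by (simp add: h_def infdist_nonneg)
  have h1: "A \<in> cubeQ" if "h A \<le> 1" for A
  proof -
    obtain B where B: "B \<in> H" "infdist A H = dist A B"
      using infdist_attains_inf[OF compact_imp_closed[OF H(1)] H(3)] by blast
    then have "A \<in> cball B \<delta>"
      using that \<delta>(1) by (simp add: h_def dist_commute)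
    then show ?thesis
      using B(1) \<delta>(2) interior_subset by blast
  qed
  have bound: "0 \<le> g A" "g A \<le> 1" if "A \<in> cubeQ" for A
    using normalized_rank_one_convex_bounds[OF g that] by auto
  have conv: "rank_one_convex_on UNIV G"
    unfolding G_def
  proof (rule glue_rank_one_convex)
    show "rank_one_convex_on cubeQ g" using g by (simp add: normalized_rank_one_convex_def)
    show "continuous_on UNIV h" unfolding h_def using \<delta> by (intro continuous_intros) auto
    fix A B :: "real^'n^'n" and t :: real assume t: "0 \<le> t" "t \<le> 1"
    have "infdist (t *\<^sub>R A + (1 - t) *\<^sub>R B) H / \<delta> \<le> (t * infdist A H + (1 - t) * infdist B H) / \<delta>"
      using \<delta>(1) convex_combination_infdist_le[OF H(1-3) t] by (intro divide_right_mono) auto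
    then show "h (t *\<^sub>R A + (1 - t) *\<^sub>R B) \<le> t * h A + (1 - t) * h B"
      by (simp add: h_def add_divide_distrib)
  qed (use bound h1 in auto)
  have "isCont G A" for A
  proof (rule coordinate_convex_on_isCont)
    have "coordinate_convex_on UNIV G"
      by (rule rank_one_convex_on_imp_coordinate_convex_on[OF conv])
    then show "coordinate_convex_on (cball A 1) G"
      unfolding coordinate_convex_on_def by blast
    show "A \<in> interior (cball A 1)" by simp
    fix B assume "B \<in> cball A 1"
    then have "infdist B H \<le> infdist A H + 1"
      using infdist_triangle[of B H A] by (simp add: dist_commute)
    then have "h B \<le> (infdist A H + 1) / \<delta>"
      unfolding h_def using \<delta>(1) by (intro divide_right_mono) auto
    moreover have "0 \<le> G B" "G B \<le> max 1 (h B)"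
      using bound[of B] h0[of B] by (auto simp: G_def)
    ultimately show "0 \<le> G B \<and> G B \<le> max 1 ((infdist A H + 1) / \<delta>)"
      by linarith
  qed
  then have "continuous_on UNIV G"
    by (simp add: continuous_at_imp_continuous_on)
  moreover have "\<forall>A\<in>H. G A = g A"
    using bound(1) H(4) interior_subset by (auto simp: G_def h_def)
  ultimately show thesis
    using that conv by blast
qed

section \<open>Jensen inequality for laminates\<close>

text \<open>All measures live on a bounded set, on which \<open>F\<close> agrees with a continuous function of bounded
  support.\<close>

lemma weak_star_limit_integral:
  fixes F :: "'a::euclidean_space \<Rightarrow> real"
  assumes lim: "weak_star_limit \<mu> \<nu>" and F: "continuous_on UNIV F" and K: "bounded K"
    and \<mu>: "\<And>k. sets (\<mu> k) = sets borel" "\<And>k. AE x in \<mu> k. x \<in> K"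
    and \<nu>: "sets \<nu> = sets borel" "AE x in \<nu>. x \<in> K"
  shows "(\<lambda>k. \<integral>x. F x \<partial>\<mu> k) \<longlonglongrightarrow> (\<integral>x. F x \<partial>\<nu>)"
proof -
  obtain R where R: "\<And>x. x \<in> K \<Longrightarrow> norm x \<le> R"
    using K by (auto simp: bounded_iff)
  define F' where "F' x = F x * max 0 (min 1 (R + 1 - norm x))" for x
  have F': "continuous_on UNIV F'"
    unfolding F'_def by (intro continuous_intros F)
  have "\<forall>\<^sub>F x in at_infinity. F' x = 0"
    unfolding eventually_at_infinity by (intro exI[of _ "R + 1"]) (auto simp: F'_def)
  then have "(F' \<longlongrightarrow> 0) at_infinity"
    by (rule tendsto_eventually)
  then have "(\<lambda>k. \<integral>x. F' x \<partial>\<mu> k) \<longlonglongrightarrow> (\<integral>x. F' x \<partial>\<nu>)"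
    using lim F' unfolding weak_star_limit_def by blast
  moreover have "(\<integral>x. F' x \<partial>\<rho>) = (\<integral>x. F x \<partial>\<rho>)" if "sets \<rho> = sets borel" "AE x in \<rho>. x \<in> K" for \<rho>
  proof (rule integral_cong_AE)
    show "F' \<in> borel_measurable \<rho>" "F \<in> borel_measurable \<rho>"
      using F F' that(1) by (simp_all add: borel_measurable_continuous_onI cong: measurable_cong_sets)
    have "F' x = F x" if "x \<in> K" for x
      using R[OF that] by (simp add: F'_def)
    then show "AE x in \<rho>. F' x = F x"
      using that(2) by (auto elim: eventually_mono)
  qed
  ultimately show ?thesis
    using \<mu> \<nu> by simp
qed

lemma tendsto_barycentre:
  fixes \<nu> :: "'a::euclidean_space measure"
  assumes lim: "weak_star_limit \<mu> \<nu>" and K: "bounded K"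
    and \<mu>: "\<And>k. sets (\<mu> k) = sets borel" "\<And>k. AE x in \<mu> k. x \<in> K" "\<And>k. integrable (\<mu> k) (\<lambda>x. x)"
    and \<nu>: "sets \<nu> = sets borel" "AE x in \<nu>. x \<in> K" "integrable \<nu> (\<lambda>x. x)"
  shows "(\<lambda>k. barycentre (\<mu> k)) \<longlonglongrightarrow> barycentre \<nu>"
  unfolding tendsto_componentwise_iff[of "\<lambda>k. barycentre (\<mu> k)"]
proof
  fix b :: 'a
  have "(\<lambda>k. \<integral>x. x \<bullet> b \<partial>\<mu> k) \<longlonglongrightarrow> (\<integral>x. x \<bullet> b \<partial>\<nu>)"
    by (rule weak_star_limit_integral[OF lim _ K \<mu>(1,2) \<nu>(1,2)]) (intro continuous_intros)
  then show "(\<lambda>k. barycentre (\<mu> k) \<bullet> b) \<longlonglongrightarrow> barycentre \<nu> \<bullet> b"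
    using \<mu>(3) \<nu>(3) by (simp add: barycentre_def)
qed

text \<open>Jensen's inequality for the approximating finite-order laminates and the extended function passes
  to the limit, as the extension is continuous and agrees with \<open>g\<close> on the convex hull of the support
  of \<open>\<nu>\<close>, which contains the barycentre.\<close>

theorem laminate_jensen:
  fixes \<nu> :: "(real^'n^'n) measure"
  assumes lam: "laminate \<nu>" and supp: "measure_support \<nu> \<subseteq> interior cubeQ"
    and g: "g \<in> normalized_rank_one_convex"
  shows "g (barycentre \<nu>) \<le> pairing \<nu> g"
proof -
  have prob: "borel_prob \<nu>" and compact: "compact (measure_support \<nu>)"
    using lam by (auto simp: laminate_def)
  interpret prob_space \<nu> using prob by (simp add: borel_prob_def)
  have sets: "sets \<nu> = sets borel" using prob by (simp add: borel_prob_def)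
  obtain \<mu> K where K: "compact K" and \<mu>: "\<And>k. finite_order_laminate (\<mu> k)"
    "\<And>k. measure_support (\<mu> k) \<subseteq> K" and lim: "weak_star_limit \<mu> \<nu>"
    using lam unfolding laminate_def by blast
  define H where "H = convex hull measure_support \<nu>"
  have AE: "AE A in \<nu>. A \<in> measure_support \<nu>"
    by (rule AE_in_measure_support[OF sets])
  have HK: "measure_support \<nu> \<subseteq> H" by (simp add: H_def hull_subset)
  have AEH: "AE A in \<nu>. A \<in> H"
    using AE HK by (auto elim: eventually_mono)
  have H: "compact H" "convex H" "H \<subseteq> interior cubeQ"
    using compact hull_minimal[of "measure_support \<nu>" "interior cubeQ" convex, OF supp]
      convex_interior[OF convex_cubeQ]
    by (simp_all add: H_def compact_convex_hull)
  have bary: "barycentre \<nu> \<in> H"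
    by (rule barycentre_in_convex[OF prob AEH H(1,2)])
  obtain G where G: "rank_one_convex_on UNIV G" "continuous_on UNIV G" "\<forall>A\<in>H. G A = g A"
    using rank_one_convex_extension[OF g H(1,2) _ H(3)] bary by blast
  have Gm: "G \<in> borel_measurable borel"
    using G(2) by (rule borel_measurable_continuous_onI)
  have \<mu>s: "sets (\<mu> k) = sets borel" "integrable (\<mu> k) (\<lambda>x. x)" for k
  proof -
    obtain ws where "\<mu> k = dirac_sum ws" "\<forall>(w, x)\<in>set ws. 0 \<le> w"
      by (rule finite_order_laminate_dirac_sum[OF \<mu>(1)])
    then show "sets (\<mu> k) = sets borel" "integrable (\<mu> k) (\<lambda>x. x)"
      by (simp_all add: integrable_dirac_sum)
  qed
  have KH: "bounded (K \<union> H)"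
    using K H(1) by (simp add: compact_imp_bounded)
  have AE\<mu>: "AE A in \<mu> k. A \<in> K \<union> H" for k
    by (rule eventually_mono[OF AE_in_measure_support[OF \<mu>s(1)]]) (use \<mu>(2) in blast)
  have AE\<nu>: "AE A in \<nu>. A \<in> K \<union> H"
    using AEH by (rule eventually_mono) auto
  have int: "integrable \<nu> (\<lambda>x. x)"
    by (rule integrable_continuous_AE_in_compact[OF finite_measure_axioms sets H(1) AEH]) (rule continuous_on_id)
  have "(\<lambda>k. barycentre (\<mu> k)) \<longlonglongrightarrow> barycentre \<nu>"
    by (rule tendsto_barycentre[OF lim KH \<mu>s(1) AE\<mu> \<mu>s(2) sets AE\<nu> int])
  then have "(\<lambda>k. G (barycentre (\<mu> k))) \<longlonglongrightarrow> G (barycentre \<nu>)"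
    using G(2) by (intro isCont_tendsto_compose[where g = G]) (auto simp: continuous_on_eq_continuous_at)
  moreover have "(\<lambda>k. \<integral>A. G A \<partial>\<mu> k) \<longlonglongrightarrow> (\<integral>A. G A \<partial>\<nu>)"
    by (rule weak_star_limit_integral[OF lim G(2) KH \<mu>s(1) AE\<mu> sets AE\<nu>])
  ultimately have "G (barycentre \<nu>) \<le> (\<integral>A. G A \<partial>\<nu>)"
    by (rule LIMSEQ_le) (use finite_order_laminate_jensen[OF \<mu>(1) G(1) Gm] in blast)
  moreover have "pairing \<nu> g = (\<integral>A. G A \<partial>\<nu>)"
    using HK G(3) by (intro pairing_eq_integral[OF sets Gm]) auto
  ultimately show ?thesis
    using G(3) bary by simp
qed

section \<open>Splitting trees\<close>

definition weighted_sum :: "('a \<Rightarrow> real) \<Rightarrow> (real \<times> 'a) list \<Rightarrow> real" where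
  "weighted_sum f ws = (\<Sum>(w, x)\<leftarrow>ws. w * f x)"

definition scale_weights :: "real \<Rightarrow> (real \<times> 'a) list \<Rightarrow> (real \<times> 'a) list" where
  "scale_weights t = map (\<lambda>(w, x). (t * w, x))"

lemma weighted_sum_simps [simp]:
  "weighted_sum f [] = 0"
  "weighted_sum f ((w, x) # ws) = w * f x + weighted_sum f ws"
  "weighted_sum f (us @ vs) = weighted_sum f us + weighted_sum f vs"
  by (simp_all add: weighted_sum_def)

lemma weighted_sum_scale_weights [simp]: "weighted_sum f (scale_weights t ws) = t * weighted_sum f ws"
  by (induction ws) (auto simp: scale_weights_def distrib_left)

lemma weighted_sum_mono:
  assumes "\<forall>(w, x)\<in>set ws. 0 \<le> w \<and> f x \<le> g x"
  shows "weighted_sum f ws \<le> weighted_sum g ws"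
  using assms by (induction ws) (auto intro!: add_mono mult_left_mono)

lemma weighted_sum_cmult: "weighted_sum (\<lambda>x. c * f x) ws = c * weighted_sum f ws"
  by (induction ws) (auto simp: distrib_left)

lemma weighted_sum_sum:
  "weighted_sum (\<lambda>x. \<Sum>i\<in>I. f i x) ws = (\<Sum>i\<in>I. weighted_sum (f i) ws)"
  by (induction ws) (auto simp: sum.distrib sum_distrib_left)

text \<open>The list contains the weighted leaves of a binary tree of rank-one splittings with root \<open>A\<close> and
  leaves in \<open>S\<close>; all nodes are in \<open>S\<close> if \<open>S\<close> is convex.  Building the tree from its two subtrees at the root, rather than splitting at the
  leaves, is what rank-one convexity of the envelope and convexity of the class require.\<close>

inductive splitting_tree :: "(real^'n^'n) set \<Rightarrow> real^'n^'n \<Rightarrow> (real \<times> (real^'n^'n)) list \<Rightarrow> bool"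
  for S where
  leaf: "A \<in> S \<Longrightarrow> splitting_tree S A [(1, A)]"
| node: "splitting_tree S B us \<Longrightarrow> splitting_tree S C vs \<Longrightarrow> rank (B - C) \<le> 1 \<Longrightarrow> 0 \<le> t \<Longrightarrow> t \<le> 1 \<Longrightarrow>
    splitting_tree S (t *\<^sub>R B + (1 - t) *\<^sub>R C) (scale_weights t us @ scale_weights (1 - t) vs)"

lemma splitting_tree_atoms: "splitting_tree S A ws \<Longrightarrow> \<forall>(w, x)\<in>set ws. 0 \<le> w \<and> x \<in> S"
  by (induction rule: splitting_tree.induct) (fastforce simp: scale_weights_def)+

lemma splitting_tree_total: "splitting_tree S A ws \<Longrightarrow> weighted_sum (\<lambda>x. c) ws = c"
  by (induction rule: splitting_tree.induct) (simp_all add: algebra_simps)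

text \<open>The first splitting may be the trivial one of \<open>A\<close> into two copies of itself, so the measures with a
  tree over \<open>A\<close> form a convex set.\<close>

lemma splitting_tree_mix:
  assumes "splitting_tree S A us" "splitting_tree S A vs" "0 \<le> t" "t \<le> 1"
  shows "splitting_tree S A (scale_weights t us @ scale_weights (1 - t) vs)"
proof -
  have "splitting_tree S (t *\<^sub>R A + (1 - t) *\<^sub>R A) (scale_weights t us @ scale_weights (1 - t) vs)"
    using assms by (intro splitting_tree.node) auto
  then show ?thesis by (simp flip: scaleR_add_left)
qed

text \<open>The atom at \<open>A\<close> is split into the root's two children, and the subtrees are grafted onto them in
  turn.  Each step has to bring the atom concerned to the end of the list, hence the
  permutations.\<close>

lemma graft_splitting_tree:
  assumes "splitting_tree S A ws" "finite_order_laminate (dirac_sum (xs @ [(l, A)]))"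
    "\<forall>(w, x)\<in>set xs. 0 \<le> w" "0 \<le> l"
  shows "finite_order_laminate (dirac_sum (xs @ scale_weights l ws))"
  using assms
proof (induction arbitrary: xs l rule: splitting_tree.induct)
  case (leaf A)
  then show ?case by (simp add: scale_weights_def)
next
  case (node B us C vs t)
  have scale: "scale_weights l (scale_weights r ws) = scale_weights (l * r) ws" for r and ws :: "(real \<times> (real^'n^'n)) list"
    by (simp add: scale_weights_def case_prod_beta mult.assoc)
  have vs: "\<forall>(w, x)\<in>set (scale_weights (l * (1 - t)) vs). 0 \<le> w"
    using splitting_tree_atoms[OF node.hyps(2)] node by (fastforce simp: scale_weights_def)
  have "finite_order_laminate (dirac_sum (xs @ [(l * t, B), (l * (1 - t), C)]))"
    by (rule finite_order_laminate.split[OF node.prems(1) refl node.prems(2,3) refl node.hyps(4,5,3)])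
  then have "finite_order_laminate (dirac_sum ((xs @ [(l * t, B)]) @ [(l * (1 - t), C)]))"
    by simp
  then have "finite_order_laminate (dirac_sum ((xs @ [(l * t, B)]) @ scale_weights (l * (1 - t)) vs))"
    using node.prems node.hyps by (intro node.IH(2)) auto
  also have "dirac_sum ((xs @ [(l * t, B)]) @ scale_weights (l * (1 - t)) vs)
      = dirac_sum ((xs @ scale_weights (l * (1 - t)) vs) @ [(l * t, B)])"
    by (rule dirac_sum_cong_mset) simp
  finally have "finite_order_laminate
      (dirac_sum ((xs @ scale_weights (l * (1 - t)) vs) @ scale_weights (l * t) us))"
    using node.prems node.hyps vs by (intro node.IH(1)) auto
  also have "dirac_sum ((xs @ scale_weights (l * (1 - t)) vs) @ scale_weights (l * t) us)
      = dirac_sum (xs @ scale_weights l (scale_weights t us @ scale_weights (1 - t) vs))"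
    by (rule dirac_sum_cong_mset) (simp add: scale[symmetric], simp add: scale_weights_def)
  finally show ?case .
qed

lemma splitting_tree_finite_order_laminate:
  assumes "splitting_tree S A ws"
  shows "finite_order_laminate (dirac_sum ws)"
proof -
  have "finite_order_laminate (dirac_sum ([] @ [(1, A)]))"
    using finite_order_laminate.dirac[of A] by (simp add: return_eq_dirac_sum)
  from graft_splitting_tree[OF assms this] show ?thesis
    by (simp add: scale_weights_def case_prod_beta)
qed

section \<open>The rank-one convex envelope\<close>

text \<open>For \<open>f\<close> bounded below on a convex set \<open>S\<close> this is the largest rank-one convex function on \<open>S\<close> below
  \<open>f\<close>.\<close>

definition rank_one_envelope :: "(real^'n^'n) set \<Rightarrow> (real^'n^'n \<Rightarrow> real) \<Rightarrow> real^'n^'n \<Rightarrow> real" where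
  "rank_one_envelope S f A = Inf (weighted_sum f ` {ws. splitting_tree S A ws})"

lemma
  assumes m: "\<And>x. x \<in> S \<Longrightarrow> m \<le> f x" and tree: "splitting_tree S A ws"
  shows weighted_sum_ge: "m \<le> weighted_sum f ws"
    and rank_one_envelope_le: "rank_one_envelope S f A \<le> weighted_sum f ws"
proof -
  have ge: "m \<le> weighted_sum f ws" if "splitting_tree S A ws" for ws
    using weighted_sum_mono[of ws "\<lambda>_. m" f] splitting_tree_atoms[OF that] splitting_tree_total[OF that] m
    by fastforce
  show "m \<le> weighted_sum f ws" by (rule ge[OF tree])
  show "rank_one_envelope S f A \<le> weighted_sum f ws"
    unfolding rank_one_envelope_def using tree ge by (intro cInf_lower bdd_belowI[of _ m]) auto
qed

lemma rank_one_envelope_ge: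
  assumes m: "\<And>x. x \<in> S \<Longrightarrow> m \<le> f x" and "A \<in> S"
  shows "m \<le> rank_one_envelope S f A"
  unfolding rank_one_envelope_def
proof (rule cInf_greatest)
  show "weighted_sum f ` {ws. splitting_tree S A ws} \<noteq> {}"
    using splitting_tree.leaf[OF \<open>A \<in> S\<close>] by auto
qed (use weighted_sum_ge[OF m] in auto)

lemma rank_one_envelope_approx:
  assumes "A \<in> S" "0 < \<epsilon>"
  obtains ws where "splitting_tree S A ws" "weighted_sum f ws < rank_one_envelope S f A + \<epsilon>"
proof -
  have "weighted_sum f ` {ws. splitting_tree S A ws} \<noteq> {}"
    using splitting_tree.leaf[OF \<open>A \<in> S\<close>] by auto
  moreover have "Inf (weighted_sum f ` {ws. splitting_tree S A ws}) < rank_one_envelope S f A + \<epsilon>"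
    using \<open>0 < \<epsilon>\<close> by (simp add: rank_one_envelope_def)
  ultimately obtain y where "y \<in> weighted_sum f ` {ws. splitting_tree S A ws}"
    "y < rank_one_envelope S f A + \<epsilon>"
    by (rule cInf_lessD[THEN bexE])
  then show thesis using that by auto
qed

text \<open>Nearly optimal trees over \<open>B\<close> and \<open>C\<close> join to a tree over a point between them.\<close>

lemma rank_one_convex_on_envelope:
  assumes m: "\<And>x. x \<in> S \<Longrightarrow> m \<le> f x"
  shows "rank_one_convex_on S (rank_one_envelope S f)"
  unfolding rank_one_convex_on_def
proof (intro ballI impI)
  fix B C and t :: real
  assume BC: "B \<in> S" "C \<in> S" and t: "t \<in> {0..1}" and rank: "rank (B - C) \<le> 1"
  show "rank_one_envelope S f (t *\<^sub>R B + (1 - t) *\<^sub>R C)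
      \<le> t * rank_one_envelope S f B + (1 - t) * rank_one_envelope S f C"
  proof (rule field_le_epsilon)
    fix \<epsilon> :: real assume "0 < \<epsilon>"
    obtain us where us: "splitting_tree S B us" "weighted_sum f us < rank_one_envelope S f B + \<epsilon>"
      by (rule rank_one_envelope_approx[OF BC(1) \<open>0 < \<epsilon>\<close>])
    obtain vs where vs: "splitting_tree S C vs" "weighted_sum f vs < rank_one_envelope S f C + \<epsilon>"
      by (rule rank_one_envelope_approx[OF BC(2) \<open>0 < \<epsilon>\<close>])
    have "splitting_tree S (t *\<^sub>R B + (1 - t) *\<^sub>R C) (scale_weights t us @ scale_weights (1 - t) vs)"
      using us vs rank t by (intro splitting_tree.node) auto
    then have "rank_one_envelope S f (t *\<^sub>R B + (1 - t) *\<^sub>R C) \<le> t * weighted_sum f us + (1 - t) * weighted_sum f vs"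
      using rank_one_envelope_le[where f = f, OF m] by fastforce
    also have "\<dots> \<le> t * (rank_one_envelope S f B + \<epsilon>) + (1 - t) * (rank_one_envelope S f C + \<epsilon>)"
      using us vs t by (intro add_mono mult_left_mono) auto
    finally show "rank_one_envelope S f (t *\<^sub>R B + (1 - t) *\<^sub>R C)
        \<le> t * rank_one_envelope S f B + (1 - t) * rank_one_envelope S f C + \<epsilon>"
      by (simp add: algebra_simps)
  qed
qed

text \<open>The hypothesis applies to the envelope \<open>e\<close> of \<open>f\<close>, made positive by adding \<open>M + 1\<close> and then
  normalized.  Since \<open>e \<le> f\<close> on the cube, this bounds \<open>e (barycentre \<nu>)\<close> by the integral of \<open>f\<close>, and \<open>e\<close> is an infimum over trees.\<close>

theorem splitting_tree_below_integral:
  fixes \<nu> :: "(real^'n^'n) measure"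
  assumes prob: "borel_prob \<nu>" and supp: "measure_support \<nu> \<subseteq> interior cubeQ"
    and ineq: "\<And>g. g \<in> normalized_rank_one_convex \<Longrightarrow> g (barycentre \<nu>) \<le> pairing \<nu> g"
    and f: "f \<in> borel_measurable borel" "\<And>A. \<bar>f A\<bar> \<le> M" and "0 < \<epsilon>"
  obtains ws where "splitting_tree cubeQ (barycentre \<nu>) ws"
    "weighted_sum f ws < (\<integral>A. f A \<partial>\<nu>) + \<epsilon>"
proof -
  interpret prob_space \<nu> using prob by (simp add: borel_prob_def)
  have sets: "sets \<nu> = sets borel" using prob by (simp add: borel_prob_def)
  let ?K = "measure_support \<nu>"
  have K: "compact ?K"
    by (rule compact_measure_support_in_cubeQ[OF supp])
  have AE: "AE A in \<nu>. A \<in> ?K" by (rule AE_in_measure_support[OF sets])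
  have KQ: "?K \<subseteq> cubeQ" using supp interior_subset by blast
  have bary: "barycentre \<nu> \<in> cubeQ"
    by (rule barycentre_in_convex[OF prob eventually_mono[OF AE] compact_cubeQ convex_cubeQ])
      (use KQ in blast)
  have fM: "- M \<le> f A" for A using f(2)[of A] by linarith
  define e where "e = rank_one_envelope cubeQ f"
  have e: "- M \<le> e A" "e A \<le> f A" if "A \<in> cubeQ" for A
    using rank_one_envelope_ge[of cubeQ "- M" f A] that fM
      rank_one_envelope_le[of cubeQ "- M" f A, OF _ splitting_tree.leaf] by (auto simp: e_def)
  define s where "s = (\<Sum>A\<in>(cube_vertices :: (real^'n^'n) set). e A + M + 1)"
  have "0 < s"
    unfolding s_def
  proof (rule sum_pos)
    show "(cube_vertices :: (real^'n^'n) set) \<noteq> {}"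
      unfolding cube_vertices_def by (auto intro!: exI[of _ 0])
    fix A :: "real^'n^'n" assume "A \<in> cube_vertices"
    then show "0 < e A + M + 1" using e(1)[of A] cube_vertices_subset by auto
  qed (rule finite_cube_vertices)
  define g where "g A = (if A \<in> cubeQ then (e A + M + 1) / s else 0)" for A
  have g: "g \<in> normalized_rank_one_convex"
  proof -
    have "(\<Sum>A\<in>(cube_vertices :: (real^'n^'n) set). g A) = (\<Sum>A\<in>(cube_vertices :: (real^'n^'n) set). (e A + M + 1) / s)"
      using cube_vertices_subset by (intro sum.cong) (auto simp: g_def)
    also have "\<dots> = 1" using \<open>0 < s\<close> by (simp add: s_def flip: sum_divide_distrib)
    finally have "(\<Sum>A\<in>(cube_vertices :: (real^'n^'n) set). g A) = 1" .
    moreover have "rank_one_convex_on cubeQ g"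
      unfolding rank_one_convex_on_def
    proof (intro ballI impI)
      fix A B :: "real^'n^'n" and t :: real
      assume AB: "A \<in> cubeQ" "B \<in> cubeQ" and t: "t \<in> {0..1}" and rank: "rank (A - B) \<le> 1"
      have P: "t *\<^sub>R A + (1 - t) *\<^sub>R B \<in> cubeQ"
        using convexD[OF convex_cubeQ AB, of t "1 - t"] t by simp
      have eP: "e (t *\<^sub>R A + (1 - t) *\<^sub>R B) \<le> t * e A + (1 - t) * e B"
        using rank_one_convex_on_envelope[of cubeQ "- M" f] AB t rank fM
        unfolding e_def rank_one_convex_on_def by blast
      have "(e (t *\<^sub>R A + (1 - t) *\<^sub>R B) + M + 1) / s \<le> (t * (e A + M + 1) + (1 - t) * (e B + M + 1)) / s"
        using \<open>0 < s\<close> eP by (intro divide_right_mono) (auto simp: algebra_simps)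
      also have "\<dots> = t * ((e A + M + 1) / s) + (1 - t) * ((e B + M + 1) / s)"
        by (simp only: add_divide_distrib[of "t * (e A + M + 1)"] times_divide_eq_right)
      finally show "g (t *\<^sub>R A + (1 - t) *\<^sub>R B) \<le> t * g A + (1 - t) * g B"
        unfolding g_def using P AB by (simp only: if_True)
    qed
    moreover have "0 \<le> g A" if "A \<in> cubeQ" for A
      using e(1)[OF that] \<open>0 < s\<close> by (simp add: g_def)
    moreover have "g A = 0" if "A \<notin> cubeQ" for A
      using that by (simp add: g_def)
    ultimately show ?thesis
      unfolding normalized_rank_one_convex_def by blast
  qed
  have intf: "integrable \<nu> f"
    using f sets by (intro integrable_const_bound[where B = M]) (auto cong: measurable_cong_sets)
  have "set_integrable \<nu> ?K g"
    by (rule set_integrable_continuous_on_compact[OF finite_measure_axioms sets K normalized_rank_one_convex_continuous_on[OF g supp]])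
  then have "pairing \<nu> g \<le> (\<integral>A. (f A + M + 1) / s \<partial>\<nu>)"
    unfolding pairing_def set_lebesgue_integral_def set_integrable_def
  proof (rule integral_mono_AE)
    show "integrable \<nu> (\<lambda>A. (f A + M + 1) / s)" using intf by simp
    show "AE A in \<nu>. indicator ?K A *\<^sub>R g A \<le> (f A + M + 1) / s"
      using AE
    proof eventually_elim
      case (elim A)
      then have "A \<in> cubeQ" using KQ by blast
      then show ?case using e(2)[of A] elim \<open>0 < s\<close> by (simp add: g_def divide_right_mono)
    qed
  qed
  also have "\<dots> = ((\<integral>A. f A \<partial>\<nu>) + M + 1) / s"
    using intf by (simp add: prob_space)
  finally have "g (barycentre \<nu>) \<le> ((\<integral>A. f A \<partial>\<nu>) + M + 1) / s"
    using ineq[OF g] by linarith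
  then have "e (barycentre \<nu>) \<le> (\<integral>A. f A \<partial>\<nu>)"
    using bary \<open>0 < s\<close> by (simp add: g_def divide_le_cancel)
  moreover obtain ws where "splitting_tree cubeQ (barycentre \<nu>) ws"
    "weighted_sum f ws < rank_one_envelope cubeQ f (barycentre \<nu>) + \<epsilon>"
    by (rule rank_one_envelope_approx[OF bary \<open>0 < \<epsilon>\<close>])
  ultimately show thesis
    using that by (auto simp: e_def)
qed

section \<open>Weak-* approximation by splitting trees\<close>

text \<open>If no linear functional separates \<open>a\<close> strictly from the convex set \<open>X\<close>, then \<open>a\<close> is in its closure.
  A nearly closest point \<open>x\<close> is improved by moving a little towards a point that is
  nearly below \<open>a\<close> for the functional with coefficients \<open>x i - a i\<close>, unless the distance is zero.\<close>

lemma convex_set_approximates_point: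
  fixes a :: "'i \<Rightarrow> real" and X :: "('i \<Rightarrow> real) set"
  assumes "finite I"
    and mix: "\<And>x y t. x \<in> X \<Longrightarrow> y \<in> X \<Longrightarrow> 0 \<le> t \<Longrightarrow> t \<le> 1 \<Longrightarrow> (\<lambda>i. (1 - t) * x i + t * y i) \<in> X"
    and bd: "\<And>x i. x \<in> X \<Longrightarrow> i \<in> I \<Longrightarrow> \<bar>x i\<bar> \<le> B"
    and below: "\<And>c \<eta>. 0 < \<eta> \<Longrightarrow> \<exists>x\<in>X. (\<Sum>i\<in>I. c i * x i) < (\<Sum>i\<in>I. c i * a i) + \<eta>"
    and "0 < \<epsilon>"
  shows "\<exists>x\<in>X. \<forall>i\<in>I. \<bar>x i - a i\<bar> < \<epsilon>"
proof -
  define \<Phi> where "\<Phi> x = (\<Sum>i\<in>I. (x i - a i)\<^sup>2)" for x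
  define d where "d = Inf (\<Phi> ` X)"
  have ne: "\<Phi> ` X \<noteq> {}" using below[of 1 "\<lambda>_. 0"] by auto
  have bdd: "bdd_below (\<Phi> ` X)"
    by (rule bdd_belowI[of _ 0]) (auto simp: \<Phi>_def intro: sum_nonneg)
  have d_le: "d \<le> \<Phi> x" if "x \<in> X" for x
    unfolding d_def using that bdd by (intro cInf_lower) auto
  have "\<not> 0 < d"
  proof
    assume "0 < d"
    define D where "D = real (card I) * (2 * B)\<^sup>2 + 1"
    have "0 < D" by (simp add: D_def add_nonneg_pos)
    define t where "t = min 1 (d / (2 * D))"
    have t: "0 < t" "t \<le> 1" and tD: "t * D \<le> d / 2"
      using \<open>0 < d\<close> \<open>0 < D\<close> by (auto simp: t_def min_def field_simps)
    define \<eta> where "\<eta> = t * d / 4"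
    have "0 < \<eta>" using t \<open>0 < d\<close> by (simp add: \<eta>_def)
    then have "Inf (\<Phi> ` X) < d + \<eta>" by (simp add: d_def)
    then obtain x where x: "x \<in> X" "\<Phi> x < d + \<eta>"
      using cInf_lessD[OF ne] by auto
    obtain y where y: "y \<in> X"
      "(\<Sum>i\<in>I. (x i - a i) * y i) < (\<Sum>i\<in>I. (x i - a i) * a i) + \<eta>"
      using below[OF \<open>0 < \<eta>\<close>, of "\<lambda>i. x i - a i"] by blast
    \<comment> \<open>The cross term of the expansion is at most \<open>\<eta> - d\<close>, and \<open>t\<close> and \<open>\<eta>\<close> are so small that it
      outweighs the quadratic term and the initial excess \<open>\<eta>\<close> over \<open>d\<close>.\<close>
    let ?z = "\<lambda>i. (1 - t) * x i + t * y i"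
    have "?z \<in> X" using mix x(1) y(1) t by simp
    have sq: "(\<Sum>i\<in>I. (y i - x i)\<^sup>2) \<le> D"
    proof -
      have "(y i - x i)\<^sup>2 \<le> (2 * B)\<^sup>2" if "i \<in> I" for i
        using bd[OF x(1) that] bd[OF y(1) that] by (intro power2_le_iff_abs_le[THEN iffD2]) auto
      then have "(\<Sum>i\<in>I. (y i - x i)\<^sup>2) \<le> (\<Sum>i\<in>I. (2 * B)\<^sup>2)" by (rule sum_mono)
      then show ?thesis by (simp add: D_def)
    qed
    have cross: "(\<Sum>i\<in>I. (x i - a i) * (y i - x i)) \<le> \<eta> - d"
    proof -
      have "(\<Sum>i\<in>I. (x i - a i) * (y i - x i))
          = (\<Sum>i\<in>I. (x i - a i) * y i - (x i - a i) * a i - (x i - a i)\<^sup>2)"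
        by (intro sum.cong refl) (simp add: algebra_simps power2_eq_square)
      also have "\<dots> = (\<Sum>i\<in>I. (x i - a i) * y i) - (\<Sum>i\<in>I. (x i - a i) * a i) - \<Phi> x"
        by (simp add: sum_subtractf \<Phi>_def)
      finally show ?thesis using y(2) d_le[OF x(1)] by linarith
    qed
    have "\<Phi> ?z = (\<Sum>i\<in>I. (x i - a i)\<^sup>2 + 2 * t * ((x i - a i) * (y i - x i)) + t\<^sup>2 * (y i - x i)\<^sup>2)"
      unfolding \<Phi>_def by (intro sum.cong refl) (simp add: algebra_simps power2_eq_square)
    also have "\<dots> = \<Phi> x + 2 * t * (\<Sum>i\<in>I. (x i - a i) * (y i - x i)) + t\<^sup>2 * (\<Sum>i\<in>I. (y i - x i)\<^sup>2)"
      by (simp add: sum.distrib \<Phi>_def sum_distrib_left)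
    also have "\<dots> \<le> (d + \<eta>) + 2 * t * (\<eta> - d) + t\<^sup>2 * D"
      using x(2) cross sq t by (intro add_mono mult_left_mono) auto
    also have "\<dots> < d"
    proof -
      have "t\<^sup>2 * D \<le> t * (d / 2)"
        using mult_left_mono[OF tD, of t] t by (simp add: power2_eq_square mult.assoc)
      moreover have "t * \<eta> \<le> \<eta>" using t \<open>0 < \<eta>\<close> by simp
      moreover have "0 < t * d" using t \<open>0 < d\<close> by simp
      moreover have "2 * t * (\<eta> - d) = 2 * (t * \<eta>) - 2 * (t * d)" by (simp add: algebra_simps)
      ultimately show ?thesis using \<eta>_def by linarith
    qed
    finally show False using d_le[OF \<open>?z \<in> X\<close>] by linarith
  qed
  then have "Inf (\<Phi> ` X) < \<epsilon>\<^sup>2" using \<open>0 < \<epsilon>\<close> by (simp add: d_def not_less order_le_less_trans)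
  then obtain x where x: "x \<in> X" "\<Phi> x < \<epsilon>\<^sup>2"
    using cInf_lessD[OF ne] by auto
  have "\<bar>x i - a i\<bar> < \<epsilon>" if "i \<in> I" for i
  proof -
    have "(x i - a i)\<^sup>2 \<le> \<Phi> x"
      unfolding \<Phi>_def using \<open>finite I\<close> that by (intro member_le_sum) auto
    then have "(x i - a i)\<^sup>2 < \<epsilon>\<^sup>2" using x(2) by linarith
    then show ?thesis using \<open>0 < \<epsilon>\<close> abs_le_square_iff[of \<epsilon> "x i - a i"] by linarith
  qed
  then show ?thesis using x(1) by blast
qed

text \<open>The functions are obtained from tent functions of radius \<open>\<delta>\<close> over a finite net.  They turn
  weak-* closeness at scale \<open>\<delta>\<close> into finitely many conditions.\<close>

lemma compact_partition_of_unity: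
  fixes K :: "'a::euclidean_space set"
  assumes "compact K" "0 < \<delta>"
  obtains Z and \<phi> :: "'a \<Rightarrow> 'a \<Rightarrow> real" where "finite Z" "Z \<subseteq> K"
    "\<forall>z. \<phi> z \<in> borel_measurable borel" "\<forall>z\<in>Z. \<forall>x. 0 \<le> \<phi> z x \<and> \<phi> z x \<le> 1"
    "\<forall>x\<in>K. (\<Sum>z\<in>Z. \<phi> z x) = 1" "\<forall>z x. \<phi> z x \<noteq> 0 \<longrightarrow> dist x z < \<delta>"
proof -
  obtain Z where Z: "finite Z" "Z \<subseteq> K" "K \<subseteq> (\<Union>z\<in>Z. ball z \<delta>)"
  proof (rule compactE_image[OF assms(1), of K "\<lambda>x. ball x \<delta>"])
    show "K \<subseteq> (\<Union>x\<in>K. ball x \<delta>)" using assms(2) by force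
  qed auto
  define \<psi> where "\<psi> z x = max 0 (\<delta> - dist x z)" for z x :: 'a
  define \<phi> where "\<phi> z x = \<psi> z x / (\<Sum>z\<in>Z. \<psi> z x)" for z x
  have \<psi>0: "0 \<le> \<psi> z x" for z x by (simp add: \<psi>_def)
  have \<psi>m: "\<psi> z \<in> borel_measurable borel" for z
    unfolding \<psi>_def by (intro borel_measurable_continuous_onI continuous_intros)
  show thesis
  proof (rule that[of Z \<phi>])
    show "\<forall>z. \<phi> z \<in> borel_measurable borel"
      unfolding \<phi>_def using \<psi>m by (auto intro!: borel_measurable_divide borel_measurable_sum)
    show "\<forall>z\<in>Z. \<forall>x. 0 \<le> \<phi> z x \<and> \<phi> z x \<le> 1"
    proof (intro ballI allI)
      fix z x assume "z \<in> Z"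
      then have "\<psi> z x \<le> (\<Sum>z\<in>Z. \<psi> z x)"
        using Z(1) \<psi>0 by (intro member_le_sum) auto
      then show "0 \<le> \<phi> z x \<and> \<phi> z x \<le> 1"
        using \<psi>0[of z x] sum_nonneg[of Z "\<lambda>z. \<psi> z x"] \<psi>0 by (auto simp: \<phi>_def divide_le_eq_1)
    qed
    show "\<forall>x\<in>K. (\<Sum>z\<in>Z. \<phi> z x) = 1"
    proof
      fix x assume "x \<in> K"
      then obtain z where "z \<in> Z" "dist x z < \<delta>" using Z(3) by (auto simp: dist_commute)
      then have "0 < (\<Sum>z\<in>Z. \<psi> z x)"
        using Z(1) \<psi>0 by (intro sum_pos2[of Z z]) (auto simp: \<psi>_def)
      then show "(\<Sum>z\<in>Z. \<phi> z x) = 1"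
        by (simp add: \<phi>_def flip: sum_divide_distrib)
    qed
    show "\<forall>z x. \<phi> z x \<noteq> 0 \<longrightarrow> dist x z < \<delta>"
      by (auto simp: \<phi>_def \<psi>_def max_def split: if_splits)
  qed (use Z in auto)
qed

text \<open>Where \<open>\<phi> z\<close> does not vanish, \<open>F\<close> differs from its value at \<open>z\<close> by at most \<open>e\<close>.\<close>

lemma integral_approx_partition:
  fixes F :: "'a::euclidean_space \<Rightarrow> real"
  assumes "prob_space \<rho>" and sets: "sets \<rho> = sets borel" and AE: "AE x in \<rho>. x \<in> K" and "compact K"
    and F: "continuous_on UNIV F"
    and osc: "\<And>x y. x \<in> K \<Longrightarrow> y \<in> K \<Longrightarrow> dist x y < \<delta> \<Longrightarrow> \<bar>F x - F y\<bar> \<le> e"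
    and Z: "finite Z" "Z \<subseteq> K"
    and \<phi>: "\<forall>z. \<phi> z \<in> borel_measurable borel" "\<forall>z\<in>Z. \<forall>x. 0 \<le> \<phi> z x \<and> \<phi> z x \<le> (1::real)"
      "\<forall>x\<in>K. (\<Sum>z\<in>Z. \<phi> z x) = 1" "\<forall>z x. \<phi> z x \<noteq> 0 \<longrightarrow> dist x z < \<delta>"
  shows "\<bar>(\<integral>x. F x \<partial>\<rho>) - (\<Sum>z\<in>Z. F z * (\<integral>x. \<phi> z x \<partial>\<rho>))\<bar> \<le> e"
proof -
  interpret prob_space \<rho> by fact
  have intF: "integrable \<rho> F"
    by (rule integrable_continuous_AE_in_compact[OF finite_measure_axioms sets assms(4) AE F])
  have int\<phi>: "integrable \<rho> (\<phi> z)" if "z \<in> Z" for z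
    using \<phi>(1,2) that sets by (intro integrable_const_bound[where B = 1] AE_I2) (auto cong: measurable_cong_sets)
  have intS: "integrable \<rho> (\<lambda>x. \<Sum>z\<in>Z. F z * \<phi> z x)"
    by (rule Bochner_Integration.integrable_sum) (simp add: int\<phi>)
  have "(\<integral>x. F x \<partial>\<rho>) - (\<Sum>z\<in>Z. F z * (\<integral>x. \<phi> z x \<partial>\<rho>)) = (\<integral>x. F x - (\<Sum>z\<in>Z. F z * \<phi> z x) \<partial>\<rho>)"
    using intF intS int\<phi> by simp
  also have "\<bar>\<dots>\<bar> \<le> (\<integral>x. \<bar>F x - (\<Sum>z\<in>Z. F z * \<phi> z x)\<bar> \<partial>\<rho>)"
    by (rule integral_abs_bound)
  also have "\<dots> \<le> (\<integral>x. e \<partial>\<rho>)"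
  proof (rule integral_mono_AE)
    show "integrable \<rho> (\<lambda>x. \<bar>F x - (\<Sum>z\<in>Z. F z * \<phi> z x)\<bar>)" "integrable \<rho> (\<lambda>x. e)"
      using intF intS by simp_all
    show "AE x in \<rho>. \<bar>F x - (\<Sum>z\<in>Z. F z * \<phi> z x)\<bar> \<le> e"
      using AE
    proof eventually_elim
      case (elim x)
      have "F x - (\<Sum>z\<in>Z. F z * \<phi> z x) = (\<Sum>z\<in>Z. \<phi> z x * (F x - F z))"
        using \<phi>(3) elim by (simp add: right_diff_distrib sum_subtractf mult.commute flip: sum_distrib_left)
      also have "\<bar>\<dots>\<bar> \<le> (\<Sum>z\<in>Z. \<bar>\<phi> z x * (F x - F z)\<bar>)" by (rule sum_abs)
      also have "\<dots> \<le> (\<Sum>z\<in>Z. \<phi> z x * e)"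
      proof (rule sum_mono)
        fix z assume z: "z \<in> Z"
        have "\<phi> z x \<noteq> 0 \<Longrightarrow> \<bar>F x - F z\<bar> \<le> e"
          using osc[of x z] elim z Z(2) \<phi>(4) by auto
        then show "\<bar>\<phi> z x * (F x - F z)\<bar> \<le> \<phi> z x * e"
          using \<phi>(2) z by (cases "\<phi> z x = 0") (auto simp: abs_mult intro: mult_left_mono)
      qed
      also have "\<dots> = e" using \<phi>(3) elim by (simp flip: sum_distrib_right)
      finally show ?case .
    qed
  qed
  finally show ?thesis by (simp add: prob_space)
qed

lemma splitting_tree_prob_space:
  assumes "splitting_tree S A ws"
  shows "prob_space (dirac_sum ws)"
proof -
  have w: "\<forall>(w, x)\<in>set ws. 0 \<le> w"
    using splitting_tree_atoms[OF assms] by auto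
  have sum: "0 \<le> weighted_sum (\<lambda>_. 1) ws \<and> (\<Sum>(w, x)\<leftarrow>ws. ennreal w) = ennreal (weighted_sum (\<lambda>_. 1) ws)"
    using w by (induction ws) (auto simp: ennreal_plus)
  have "emeasure (dirac_sum ws) UNIV = (\<Sum>(w, x)\<leftarrow>ws. ennreal w)"
    by (simp add: emeasure_dirac_sum)
  also have "\<dots> = 1"
    using sum splitting_tree_total[OF assms] by simp
  finally show "prob_space (dirac_sum ws)"
    by (intro prob_spaceI) (simp add: sets_eq_imp_space_eq[OF sets_dirac_sum])
qed

lemma splitting_tree_support:
  assumes tree: "splitting_tree S A ws" and "closed S"
  shows "measure_support (dirac_sum ws) \<subseteq> S"
proof
  fix x assume x: "x \<in> measure_support (dirac_sum ws)"
  have "- S \<in> sets borel" using \<open>closed S\<close> by auto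
  then have "emeasure (dirac_sum ws) (- S) = (\<Sum>(w, x)\<leftarrow>ws. ennreal w * indicator (- S) x)"
    by (rule emeasure_dirac_sum)
  also have "\<dots> = (\<Sum>(w, x)\<leftarrow>ws. 0)"
    using splitting_tree_atoms[OF tree] by (intro arg_cong[where f = sum_list] map_cong) auto
  also have "\<dots> = 0" by (induction ws) auto
  finally have null: "emeasure (dirac_sum ws) (- S) = 0" .
  show "x \<in> S"
  proof (rule ccontr)
    assume "x \<notin> S"
    then have "0 < emeasure (dirac_sum ws) (- S)"
      using x open_Compl[OF \<open>closed S\<close>] unfolding measure_support_def by simp
    then show False using null by simp
  qed
qed

text \<open>The tree is chosen so that its integrals of the finitely many functions of the partition are close
  to those of \<open>\<nu>\<close>.  Such a tree exists because linear combinations of these functions are bounded Borel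
  functions, for each of which some tree has an integral that hardly exceeds the one for \<open>\<nu>\<close>.\<close>

lemma approximating_splitting_tree:
  fixes \<nu> :: "(real^'n^'n) measure"
  assumes prob: "borel_prob \<nu>" and supp: "measure_support \<nu> \<subseteq> interior cubeQ"
    and ineq: "\<And>g. g \<in> normalized_rank_one_convex \<Longrightarrow> g (barycentre \<nu>) \<le> pairing \<nu> g"
    and "0 < \<delta>"
  shows "\<exists>ws. splitting_tree cubeQ (barycentre \<nu>) ws \<and>
    (\<forall>F B e. continuous_on UNIV F \<and> (\<forall>x\<in>cubeQ. \<bar>F x\<bar> \<le> B) \<and>
       (\<forall>x\<in>cubeQ. \<forall>y\<in>cubeQ. dist x y < \<delta> \<longrightarrow> \<bar>F x - F y\<bar> \<le> e) \<longrightarrow>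
       \<bar>(\<integral>x. F x \<partial>dirac_sum ws) - (\<integral>x. F x \<partial>\<nu>)\<bar> \<le> 2 * e + B * \<delta>)"
proof -
  have \<nu>: "prob_space \<nu>" "sets \<nu> = sets borel" using prob by (auto simp: borel_prob_def)
  have AE: "AE x in \<nu>. x \<in> cubeQ"
    using AE_in_measure_support[OF \<nu>(2)] supp interior_subset by (auto elim!: eventually_mono)
  obtain Z and \<phi> :: "real^'n^'n \<Rightarrow> real^'n^'n \<Rightarrow> real" where Z: "finite Z" "Z \<subseteq> cubeQ"
    and \<phi>: "\<forall>z. \<phi> z \<in> borel_measurable borel" "\<forall>z\<in>Z. \<forall>x. 0 \<le> \<phi> z x \<and> \<phi> z x \<le> 1"
    "\<forall>x\<in>cubeQ. (\<Sum>z\<in>Z. \<phi> z x) = 1" "\<forall>z x. \<phi> z x \<noteq> 0 \<longrightarrow> dist x z < \<delta>"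
    by (rule compact_partition_of_unity[OF compact_cubeQ \<open>0 < \<delta>\<close>])
  have int\<phi>: "integrable \<nu> (\<phi> z)" if "z \<in> Z" for z
  proof -
    interpret prob_space \<nu> by fact
    show ?thesis
      using \<phi>(1,2) that \<nu>(2) by (intro integrable_const_bound[where B = 1] AE_I2) (auto cong: measurable_cong_sets)
  qed
  define \<epsilon> where "\<epsilon> = \<delta> / (real (card Z) + 1)"
  have "0 < \<epsilon>" using \<open>0 < \<delta>\<close> by (simp add: \<epsilon>_def)
  define X where "X = (\<lambda>ws z. weighted_sum (\<phi> z) ws) ` {ws. splitting_tree cubeQ (barycentre \<nu>) ws}"
  have "\<exists>x\<in>X. \<forall>z\<in>Z. \<bar>x z - (\<integral>x. \<phi> z x \<partial>\<nu>)\<bar> < \<epsilon>"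
  proof (rule convex_set_approximates_point[where B = 1, OF Z(1) _ _ _ \<open>0 < \<epsilon>\<close>])
    fix x y and t :: real assume "x \<in> X" "y \<in> X" and t: "0 \<le> t" "t \<le> 1"
    then obtain us vs where us: "splitting_tree cubeQ (barycentre \<nu>) us" "x = (\<lambda>z. weighted_sum (\<phi> z) us)"
      and vs: "splitting_tree cubeQ (barycentre \<nu>) vs" "y = (\<lambda>z. weighted_sum (\<phi> z) vs)"
      by (auto simp: X_def)
    have "splitting_tree cubeQ (barycentre \<nu>) (scale_weights (1 - t) us @ scale_weights (1 - (1 - t)) vs)"
      using t by (intro splitting_tree_mix us(1) vs(1)) auto
    then show "(\<lambda>i. (1 - t) * x i + t * y i) \<in> X"
      unfolding X_def us(2) vs(2) by (rule_tac image_eqI[rotated]) auto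
  next
    fix x z assume "x \<in> X" and z: "z \<in> Z"
    then obtain ws where ws: "splitting_tree cubeQ (barycentre \<nu>) ws" "x z = weighted_sum (\<phi> z) ws"
      by (auto simp: X_def)
    have "weighted_sum (\<lambda>_. 0) ws \<le> x z" "x z \<le> weighted_sum (\<lambda>_. 1) ws"
      unfolding ws(2) using splitting_tree_atoms[OF ws(1)] \<phi>(2) z by (auto intro!: weighted_sum_mono)
    then show "\<bar>x z\<bar> \<le> 1" by (simp add: splitting_tree_total[OF ws(1)])
  next
    fix c :: "real^'n^'n \<Rightarrow> real" and \<eta> :: real assume "0 < \<eta>"
    define f where "f x = (\<Sum>z\<in>Z. c z * \<phi> z x)" for x
    have "f \<in> borel_measurable borel"
      unfolding f_def using \<phi>(1) by (intro borel_measurable_sum borel_measurable_times) auto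
    moreover have "\<bar>f x\<bar> \<le> (\<Sum>z\<in>Z. \<bar>c z\<bar>)" for x
    proof -
      have "\<bar>c z * \<phi> z x\<bar> \<le> \<bar>c z\<bar>" if "z \<in> Z" for z
        using \<phi>(2) that by (auto simp: abs_mult intro: mult_left_le)
      then show ?thesis unfolding f_def by (intro order_trans[OF sum_abs] sum_mono)
    qed
    ultimately obtain ws where ws: "splitting_tree cubeQ (barycentre \<nu>) ws"
      "weighted_sum f ws < (\<integral>x. f x \<partial>\<nu>) + \<eta>"
      using splitting_tree_below_integral[OF prob supp ineq _ _ \<open>0 < \<eta>\<close>, of f] by blast
    have "weighted_sum f ws = (\<Sum>z\<in>Z. c z * weighted_sum (\<phi> z) ws)"
      unfolding f_def by (simp add: weighted_sum_sum weighted_sum_cmult)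
    moreover have "(\<integral>x. f x \<partial>\<nu>) = (\<Sum>z\<in>Z. c z * (\<integral>x. \<phi> z x \<partial>\<nu>))"
      unfolding f_def using int\<phi> by simp
    ultimately show "\<exists>x\<in>X. (\<Sum>z\<in>Z. c z * x z) < (\<Sum>z\<in>Z. c z * (\<integral>x. \<phi> z x \<partial>\<nu>)) + \<eta>"
      using ws by (auto simp: X_def)
  qed
  then obtain ws where ws: "splitting_tree cubeQ (barycentre \<nu>) ws"
    and close: "\<And>z. z \<in> Z \<Longrightarrow> \<bar>weighted_sum (\<phi> z) ws - (\<integral>x. \<phi> z x \<partial>\<nu>)\<bar> < \<epsilon>"
    by (auto simp: X_def)
  have w: "\<forall>(w, x)\<in>set ws. 0 \<le> w"
    using splitting_tree_atoms[OF ws] by auto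
  have AEws: "AE x in dirac_sum ws. x \<in> cubeQ"
    using AE_in_measure_support[OF sets_dirac_sum[of ws]] splitting_tree_support[OF ws compact_imp_closed[OF compact_cubeQ]]
    by (auto elim!: eventually_mono)
  show ?thesis
  proof (intro exI[of _ ws] conjI allI impI)
    show "splitting_tree cubeQ (barycentre \<nu>) ws" by (rule ws)
    fix F :: "real^'n^'n \<Rightarrow> real" and B e
    assume F: "continuous_on UNIV F \<and> (\<forall>x\<in>cubeQ. \<bar>F x\<bar> \<le> B) \<and>
       (\<forall>x\<in>cubeQ. \<forall>y\<in>cubeQ. dist x y < \<delta> \<longrightarrow> \<bar>F x - F y\<bar> \<le> e)"
    have 1: "\<bar>(\<integral>x. F x \<partial>\<rho>) - (\<Sum>z\<in>Z. F z * (\<integral>x. \<phi> z x \<partial>\<rho>))\<bar> \<le> e"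
      if "prob_space \<rho>" "sets \<rho> = sets borel" "AE x in \<rho>. x \<in> cubeQ" for \<rho>
      using F by (intro integral_approx_partition[OF that compact_cubeQ _ _ Z \<phi>]) auto
    have "(0::real^'n^'n) \<in> cubeQ" by (simp add: cubeQ_def)
    then have "0 \<le> B" using F abs_ge_zero order_trans by blast
    have "(\<Sum>z\<in>Z. F z * (\<integral>x. \<phi> z x \<partial>dirac_sum ws)) - (\<Sum>z\<in>Z. F z * (\<integral>x. \<phi> z x \<partial>\<nu>))
        = (\<Sum>z\<in>Z. F z * (weighted_sum (\<phi> z) ws - (\<integral>x. \<phi> z x \<partial>\<nu>)))"
      using \<phi>(1) by (simp add: integral_dirac_sum[OF w] weighted_sum_def right_diff_distrib sum_subtractf)
    also have "\<bar>\<dots>\<bar> \<le> (\<Sum>z\<in>Z. \<bar>F z * (weighted_sum (\<phi> z) ws - (\<integral>x. \<phi> z x \<partial>\<nu>))\<bar>)"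
      by (rule sum_abs)
    also have "\<dots> \<le> (\<Sum>z\<in>Z. B * \<epsilon>)"
    proof (rule sum_mono)
      fix z assume z: "z \<in> Z"
      have "\<bar>F z\<bar> \<le> B" using F z Z(2) by blast
      then show "\<bar>F z * (weighted_sum (\<phi> z) ws - (\<integral>x. \<phi> z x \<partial>\<nu>))\<bar> \<le> B * \<epsilon>"
        unfolding abs_mult using close[OF z] \<open>0 \<le> B\<close> by (intro mult_mono) auto
    qed
    also have "\<dots> = B * (card Z * \<epsilon>)" by simp
    also have "\<dots> \<le> B * \<delta>"
      using \<open>0 \<le> B\<close> \<open>0 < \<delta>\<close> by (intro mult_left_mono) (auto simp: \<epsilon>_def field_simps)
    finally have "\<bar>(\<Sum>z\<in>Z. F z * (\<integral>x. \<phi> z x \<partial>dirac_sum ws)) - (\<Sum>z\<in>Z. F z * (\<integral>x. \<phi> z x \<partial>\<nu>))\<bar> \<le> B * \<delta>" .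
    then show "\<bar>(\<integral>x. F x \<partial>dirac_sum ws) - (\<integral>x. F x \<partial>\<nu>)\<bar> \<le> 2 * e + B * \<delta>"
      using 1[OF \<nu> AE] 1[OF splitting_tree_prob_space[OF ws] sets_dirac_sum AEws] by linarith
  qed
qed

text \<open>Trees that approximate \<open>\<nu>\<close> at scale \<open>1 / (k + 1)\<close> converge to it, because a continuous function
  oscillates little at small scales on the compact cube.\<close>

theorem laminate_if_jensen:
  fixes \<nu> :: "(real^'n^'n) measure"
  assumes prob: "borel_prob \<nu>" and supp: "measure_support \<nu> \<subseteq> interior cubeQ"
    and ineq: "\<And>g. g \<in> normalized_rank_one_convex \<Longrightarrow> g (barycentre \<nu>) \<le> pairing \<nu> g"
  shows "laminate \<nu>"
proof -
  define \<delta> where "\<delta> k = inverse (real (Suc k))" for k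
  have \<delta>: "0 < \<delta> k" for k by (simp add: \<delta>_def)
  have \<delta>0: "\<delta> \<longlonglongrightarrow> 0" unfolding \<delta>_def by (rule LIMSEQ_inverse_real_of_nat)
  obtain ws where ws: "\<And>k. splitting_tree cubeQ (barycentre \<nu>) (ws k)"
    and approx: "\<And>k F B e. continuous_on UNIV F \<Longrightarrow> \<forall>x\<in>cubeQ. \<bar>F x\<bar> \<le> B \<Longrightarrow>
       \<forall>x\<in>cubeQ. \<forall>y\<in>cubeQ. dist x y < \<delta> k \<longrightarrow> \<bar>F x - F y\<bar> \<le> e \<Longrightarrow>
       \<bar>(\<integral>x. F x \<partial>dirac_sum (ws k)) - (\<integral>x. F x \<partial>\<nu>)\<bar> \<le> 2 * e + B * \<delta> k"
    using approximating_splitting_tree[OF prob supp ineq \<delta>] by metis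
  have "weak_star_limit (\<lambda>k. dirac_sum (ws k)) \<nu>"
    unfolding weak_star_limit_def
  proof (intro allI impI)
    fix F :: "real^'n^'n \<Rightarrow> real" assume F: "continuous_on UNIV F \<and> (F \<longlongrightarrow> 0) at_infinity"
    then have FQ: "continuous_on cubeQ F" using continuous_on_subset by blast
    obtain B where B: "0 < B" "\<forall>x\<in>cubeQ. \<bar>F x\<bar> \<le> B"
      using compact_imp_bounded[OF compact_continuous_image[OF FQ compact_cubeQ]] by (auto simp: bounded_pos)
    show "(\<lambda>k. \<integral>x. F x \<partial>dirac_sum (ws k)) \<longlonglongrightarrow> (\<integral>x. F x \<partial>\<nu>)"
      unfolding tendsto_iff
    proof (intro allI impI)
      fix \<epsilon> :: real assume "0 < \<epsilon>"
      obtain d where d: "0 < d" "\<And>x y. x \<in> cubeQ \<Longrightarrow> y \<in> cubeQ \<Longrightarrow> dist y x < d \<Longrightarrow> dist (F y) (F x) < \<epsilon> / 4"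
        using compact_uniformly_continuous[OF FQ compact_cubeQ] \<open>0 < \<epsilon>\<close>
        unfolding uniformly_continuous_on_def by (metis zero_less_divide_iff zero_less_numeral)
      have "\<forall>\<^sub>F k in sequentially. \<delta> k < min d (\<epsilon> / (2 * B))"
        using \<delta>0 d(1) B(1) \<open>0 < \<epsilon>\<close> by (intro order_tendstoD(2)) auto
      then show "\<forall>\<^sub>F k in sequentially. dist (\<integral>x. F x \<partial>dirac_sum (ws k)) (\<integral>x. F x \<partial>\<nu>) < \<epsilon>"
      proof eventually_elim
        case (elim k)
        have "\<bar>F x - F y\<bar> \<le> \<epsilon> / 4" if "x \<in> cubeQ" "y \<in> cubeQ" "dist x y < \<delta> k" for x y
          using d(2)[of y x] that elim by (simp add: dist_real_def)
        then have "\<bar>(\<integral>x. F x \<partial>dirac_sum (ws k)) - (\<integral>x. F x \<partial>\<nu>)\<bar> \<le> 2 * (\<epsilon> / 4) + B * \<delta> k"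
          using F B(2) by (intro approx) auto
        moreover have "B * \<delta> k < \<epsilon> / 2"
          using elim B(1) by (simp add: field_simps)
        ultimately show ?case by (simp add: dist_real_def)
      qed
    qed
  qed
  moreover have "finite_order_laminate (dirac_sum (ws k)) \<and> measure_support (dirac_sum (ws k)) \<subseteq> cubeQ" for k
    using splitting_tree_finite_order_laminate[OF ws]
      splitting_tree_support[OF ws compact_imp_closed[OF compact_cubeQ]] by blast
  moreover have "compact (measure_support \<nu>)"
    by (rule compact_measure_support_in_cubeQ[OF supp])
  ultimately show ?thesis
    unfolding laminate_def
    by (intro conjI prob exI[of _ "\<lambda>k. dirac_sum (ws k)"] exI[of _ cubeQ] compact_cubeQ allI) auto
qed

section \<open>Characterization of laminates by extreme points\<close>

theorem theorem1p2:
  fixes \<nu> :: "(real^'n^'n) measure"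
  assumes "borel_prob \<nu>"
    and "measure_support \<nu> \<subseteq> interior cubeQ"
  shows "laminate \<nu> \<longleftrightarrow>
    (\<forall>g. g extreme_point_of normalized_rank_one_convex \<longrightarrow> g (barycentre \<nu>) \<le> pairing \<nu> g)"
proof (intro iffI allI impI)
  fix g :: "real^'n^'n \<Rightarrow> real"
  assume lam: "laminate \<nu>" and g: "g extreme_point_of normalized_rank_one_convex"
  have "g \<in> normalized_rank_one_convex"
    using g by (simp add: extreme_point_of_def)
  then show "g (barycentre \<nu>) \<le> pairing \<nu> g"
    by (rule laminate_jensen[OF lam assms(2)])
next
  assume ext: "\<forall>g::real^'n^'n \<Rightarrow> real. g extreme_point_of normalized_rank_one_convex \<longrightarrow> g (barycentre \<nu>) \<le> pairing \<nu> g"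
  show "laminate \<nu>"
  proof (rule laminate_if_jensen[OF assms])
    fix f :: "real^'n^'n \<Rightarrow> real" assume f: "f \<in> normalized_rank_one_convex"
    show "f (barycentre \<nu>) \<le> pairing \<nu> f"
      by (rule inequality_on_extreme_points_suffices[OF assms _ f]) (use ext in blast)
  qed
qed

end
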